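(* Let $H$ be a discrete commutative hypergroup which satisfies $(P_2)$, with normalized Haar measure $\lambda$. If the hypergroup algebra $L^1(H)$ is amenable as a Banach algebra, then there is some $M\ge 1$ such that $\{x\in H:\lambda(x)\le M\}$ is infinite.
   Context: A discrete hypergroup is a set $H$ with an associative bilinear convolution $*$ on $\ell^1(H)$ such that each $\delta_x*\delta_y$ is a finitely supported probability measure; there is an identity $e$ with $\delta_e*\delta_x=\delta_x=\delta_x*\delta_e$; there is an involution $x\mapsto\tilde x$ of $H$ with $(\delta_x*\delta_y)^{\sim}=\delta_{\tilde y}*\delta_{\tilde x}$; and $e\in\operatorname{supp}(\delta_x*\delta_y)$ iff $x=\tilde y$. It is commutative if $\delta_x*\delta_y=\delta_y*\delta_x$ for all $x,y$. Put $L_xf(y)=\sum_z f(z)\,(\delta_{\tilde x}*\delta_y)(z)$. The Haar measure $\lambda$ is the positive measure with $\sum_y L_xf(y)\lambda(y)=\sum_y f(y)\lambda(y)$ for all finitely supported $f$ and $x\in H$, normalized by $\lambda(e)=1$, where $\lambda(x):=\lambda(\{x\})$. $L^p(H)=L^p(H,\lambda)$. The hypergroup algebra is the Banach algebra $L^1(H)$ with product $f*_\lambda g(x)=\sum_t f(t)\,L_tg(x)\,\lambda(t)$. $H$ satisfies $(P_2)$ if for every $\epsilon>0$ and every finite (equivalently, compact) $K\subseteq H$ there is $\xi\in L^2(H)$ with $\xi\ge0$, $\|\xi\|_2=1$ and $\|\delta_x*\xi-\xi\|_2<\epsilon$ for all $x\in K$, where $\delta_x*\xi=L_x\xi$. A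 Banach algebra $A$ is amenable if every bounded derivation from $A$ into a dual Banach $A$-bimodule is inner.
   Formalization: The formal theorem additionally assumes that H is infinite; for finite H (for example the trivial group) all the hypotheses hold but no subset of H is infinite, so the claim fails as stated. *)

theory Defs
  imports "HOL-Probability.Probability"
begin

section \<open>Discrete hypergroups\<close>

text \<open>
  A bounded bilinear convolution on \<open>\<ell>\<^sup>1(H)\<close> is determined by the products of point masses;
  \<open>hconv H x y\<close> is the probability measure \<open>\<delta>\<^sub>x * \<delta>\<^sub>y\<close>, and the bilinear extension to
  probability measures is given by \<^const>\<open>bind_pmf\<close>.  The underlying set is the whole type.
\<close>

record 'h hypergroup_data =
  hconv :: "'h \<Rightarrow> 'h \<Rightarrow> 'h pmf"
  hunit :: 'h
  hinv :: "'h \<Rightarrow> 'h"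

locale discrete_hypergroup =
  fixes H :: "'h hypergroup_data"
  assumes finite_supp: "finite (set_pmf (hconv H x y))"
    and assoc: "bind_pmf (hconv H x y) (\<lambda>u. hconv H u z) = bind_pmf (hconv H y z) (\<lambda>v. hconv H x v)"
    and unit_left: "hconv H (hunit H) x = return_pmf x"
    and unit_right: "hconv H x (hunit H) = return_pmf x"
    and inv_inv: "hinv H (hinv H x) = x"
    and inv_conv: "map_pmf (hinv H) (hconv H x y) = hconv H (hinv H y) (hinv H x)"
    and unit_in_supp: "hunit H \<in> set_pmf (hconv H x y) \<longleftrightarrow> x = hinv H y"

locale commutative_discrete_hypergroup = discrete_hypergroup +
  assumes comm: "hconv H x y = hconv H y x"

definition ltrans :: "'h hypergroup_data \<Rightarrow> 'h \<Rightarrow> ('h \<Rightarrow> 'b::real_vector) \<Rightarrow> 'h \<Rightarrow> 'b" where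
  "ltrans H x f y = (\<Sum>z\<in>set_pmf (hconv H (hinv H x) y). pmf (hconv H (hinv H x) y) z *\<^sub>R f z)"

text \<open>
  Measures are given by their point masses.  In a hypergroup the translate of a finitely supported
  function is finitely supported, so both sums below are finite.
\<close>

definition haar_measure :: "'h hypergroup_data \<Rightarrow> ('h \<Rightarrow> real) \<Rightarrow> bool" where
  "haar_measure H \<mu> \<longleftrightarrow>
     (\<forall>x. 0 \<le> \<mu> x) \<and> \<mu> (hunit H) = 1 \<and>
     (\<forall>x (f :: 'h \<Rightarrow> complex). finite {z. f z \<noteq> 0} \<longrightarrow>
        (\<Sum>\<^sub>\<infinity>y. ltrans H x f y * of_real (\<mu> y)) = (\<Sum>\<^sub>\<infinity>y. f y * of_real (\<mu> y)))"

definition Lp :: "real \<Rightarrow> ('h \<Rightarrow> real) \<Rightarrow> ('h \<Rightarrow> 'b::real_normed_vector) set" where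
  "Lp p \<mu> = {f. (\<lambda>x. norm (f x) powr p * \<mu> x) summable_on UNIV}"

definition Lp_norm :: "real \<Rightarrow> ('h \<Rightarrow> real) \<Rightarrow> ('h \<Rightarrow> 'b::real_normed_vector) \<Rightarrow> real" where
  "Lp_norm p \<mu> f = (\<Sum>\<^sub>\<infinity>x. norm (f x) powr p * \<mu> x) powr (1 / p)"

definition P2 :: "'h hypergroup_data \<Rightarrow> ('h \<Rightarrow> real) \<Rightarrow> bool" where
  "P2 H \<mu> \<longleftrightarrow>
     (\<forall>\<epsilon>>0. \<forall>K. finite K \<longrightarrow>
        (\<exists>\<xi> :: 'h \<Rightarrow> real. \<xi> \<in> Lp 2 \<mu> \<and> (\<forall>x. 0 \<le> \<xi> x) \<and> Lp_norm 2 \<mu> \<xi> = 1 \<and>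
           (\<forall>x\<in>K. Lp_norm 2 \<mu> (\<lambda>y. ltrans H x \<xi> y - \<xi> y) < \<epsilon>)))"


section \<open>Banach algebras, Banach bimodules and amenability\<close>

text \<open>
  Since amenability quantifies over all Banach bimodules, complex Banach spaces are represented by
  records with an explicit carrier set.
\<close>

record 'x nspace =
  vcarrier :: "'x set"
  vzero :: 'x
  vadd :: "'x \<Rightarrow> 'x \<Rightarrow> 'x"
  vscale :: "complex \<Rightarrow> 'x \<Rightarrow> 'x"
  vnorm :: "'x \<Rightarrow> real"

definition vminus :: "('x, 'm) nspace_scheme \<Rightarrow> 'x \<Rightarrow> 'x \<Rightarrow> 'x" where
  "vminus X x y = vadd X x (vscale X (-1) y)"

locale complex_banach_space =
  fixes X :: "('x, 'm) nspace_scheme"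
  assumes zero_closed: "vzero X \<in> vcarrier X"
    and add_closed: "\<lbrakk>x \<in> vcarrier X; y \<in> vcarrier X\<rbrakk> \<Longrightarrow> vadd X x y \<in> vcarrier X"
    and scale_closed: "x \<in> vcarrier X \<Longrightarrow> vscale X c x \<in> vcarrier X"
    and add_assoc: "\<lbrakk>x \<in> vcarrier X; y \<in> vcarrier X; z \<in> vcarrier X\<rbrakk>
          \<Longrightarrow> vadd X (vadd X x y) z = vadd X x (vadd X y z)"
    and add_comm: "\<lbrakk>x \<in> vcarrier X; y \<in> vcarrier X\<rbrakk> \<Longrightarrow> vadd X x y = vadd X y x"
    and add_zero: "x \<in> vcarrier X \<Longrightarrow> vadd X x (vzero X) = x"
    and add_neg: "x \<in> vcarrier X \<Longrightarrow> vminus X x x = vzero X"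
    and scale_one: "x \<in> vcarrier X \<Longrightarrow> vscale X 1 x = x"
    and scale_scale: "x \<in> vcarrier X \<Longrightarrow> vscale X c (vscale X d x) = vscale X (c * d) x"
    and scale_add_left: "x \<in> vcarrier X \<Longrightarrow> vscale X (c + d) x = vadd X (vscale X c x) (vscale X d x)"
    and scale_add_right: "\<lbrakk>x \<in> vcarrier X; y \<in> vcarrier X\<rbrakk>
          \<Longrightarrow> vscale X c (vadd X x y) = vadd X (vscale X c x) (vscale X c y)"
    and norm_nonneg: "x \<in> vcarrier X \<Longrightarrow> 0 \<le> vnorm X x"
    and norm_eq_0: "x \<in> vcarrier X \<Longrightarrow> vnorm X x = 0 \<longleftrightarrow> x = vzero X"
    and norm_scale: "x \<in> vcarrier X \<Longrightarrow> vnorm X (vscale X c x) = cmod c * vnorm X x"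
    and norm_triangle: "\<lbrakk>x \<in> vcarrier X; y \<in> vcarrier X\<rbrakk>
          \<Longrightarrow> vnorm X (vadd X x y) \<le> vnorm X x + vnorm X y"
    and complete: "Metric_space.mcomplete (vcarrier X) (\<lambda>x y. vnorm X (vminus X x y))"

definition clinear_map :: "('x, 'm) nspace_scheme \<Rightarrow> ('y, 'n) nspace_scheme \<Rightarrow> ('x \<Rightarrow> 'y) \<Rightarrow> bool" where
  "clinear_map X Y T \<longleftrightarrow>
     (\<forall>x\<in>vcarrier X. T x \<in> vcarrier Y) \<and>
     (\<forall>x\<in>vcarrier X. \<forall>y\<in>vcarrier X. T (vadd X x y) = vadd Y (T x) (T y)) \<and>
     (\<forall>c. \<forall>x\<in>vcarrier X. T (vscale X c x) = vscale Y c (T x))"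

definition bounded_clinear_map :: "('x, 'm) nspace_scheme \<Rightarrow> ('y, 'n) nspace_scheme \<Rightarrow> ('x \<Rightarrow> 'y) \<Rightarrow> bool" where
  "bounded_clinear_map X Y T \<longleftrightarrow>
     clinear_map X Y T \<and> (\<exists>C. \<forall>x\<in>vcarrier X. vnorm Y (T x) \<le> C * vnorm X x)"

record 'a nalgebra = "'a nspace" +
  amult :: "'a \<Rightarrow> 'a \<Rightarrow> 'a"

locale banach_algebra = complex_banach_space A for A :: "('a, 'm) nalgebra_scheme" +
  assumes mult_linear_right: "a \<in> vcarrier A \<Longrightarrow> clinear_map A A (\<lambda>b. amult A a b)"
    and mult_linear_left: "b \<in> vcarrier A \<Longrightarrow> clinear_map A A (\<lambda>a. amult A a b)"
    and mult_assoc: "\<lbrakk>a \<in> vcarrier A; b \<in> vcarrier A; c \<in> vcarrier A\<rbrakk>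
          \<Longrightarrow> amult A (amult A a b) c = amult A a (amult A b c)"
    and norm_mult: "\<lbrakk>a \<in> vcarrier A; b \<in> vcarrier A\<rbrakk>
          \<Longrightarrow> vnorm A (amult A a b) \<le> vnorm A a * vnorm A b"

record ('a, 'x) nbimodule = "'x nspace" +
  lact :: "'a \<Rightarrow> 'x \<Rightarrow> 'x"
  ract :: "'x \<Rightarrow> 'a \<Rightarrow> 'x"

locale banach_bimodule = A: banach_algebra A + X: complex_banach_space X
  for A :: "'a nalgebra" and X :: "('a, 'x) nbimodule" +
  assumes lact_linear: "a \<in> vcarrier A \<Longrightarrow> clinear_map X X (\<lambda>x. lact X a x)"
    and lact_linear_alg: "x \<in> vcarrier X \<Longrightarrow> clinear_map A X (\<lambda>a. lact X a x)"
    and ract_linear: "a \<in> vcarrier A \<Longrightarrow> clinear_map X X (\<lambda>x. ract X x a)"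
    and ract_linear_alg: "x \<in> vcarrier X \<Longrightarrow> clinear_map A X (\<lambda>a. ract X x a)"
    and lact_mult: "\<lbrakk>a \<in> vcarrier A; b \<in> vcarrier A; x \<in> vcarrier X\<rbrakk>
          \<Longrightarrow> lact X (amult A a b) x = lact X a (lact X b x)"
    and ract_mult: "\<lbrakk>a \<in> vcarrier A; b \<in> vcarrier A; x \<in> vcarrier X\<rbrakk>
          \<Longrightarrow> ract X x (amult A a b) = ract X (ract X x a) b"
    and lact_ract: "\<lbrakk>a \<in> vcarrier A; b \<in> vcarrier A; x \<in> vcarrier X\<rbrakk>
          \<Longrightarrow> ract X (lact X a x) b = lact X a (ract X x b)"
    and act_bounded: "\<exists>C. \<forall>a\<in>vcarrier A. \<forall>x\<in>vcarrier X.
          vnorm X (lact X a x) \<le> C * vnorm A a * vnorm X x \<and>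
          vnorm X (ract X x a) \<le> C * vnorm A a * vnorm X x"

definition complex_space :: "complex nspace" where
  "complex_space = \<lparr>vcarrier = UNIV, vzero = 0, vadd = (+), vscale = (*), vnorm = cmod\<rparr>"

text \<open>
  The dual bimodule, with \<open>(a \<cdot> \<phi>)(x) = \<phi>(x \<cdot> a)\<close> and \<open>(\<phi> \<cdot> a)(x) = \<phi>(a \<cdot> x)\<close>.  A functional is
  made a unique HOL function by requiring the value 0 outside the carrier.
\<close>

definition dual_bimodule :: "('a, 'x) nbimodule \<Rightarrow> ('a, 'x \<Rightarrow> complex) nbimodule" where
  "dual_bimodule X =
     \<lparr>vcarrier = {\<phi>. bounded_clinear_map X complex_space \<phi> \<and> (\<forall>x. x \<notin> vcarrier X \<longrightarrow> \<phi> x = 0)},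
      vzero = (\<lambda>x. 0),
      vadd = (\<lambda>\<phi> \<psi> x. \<phi> x + \<psi> x),
      vscale = (\<lambda>c \<phi> x. c * \<phi> x),
      vnorm = (\<lambda>\<phi>. SUP x\<in>{x \<in> vcarrier X. vnorm X x \<le> 1}. cmod (\<phi> x)),
      lact = (\<lambda>a \<phi> x. if x \<in> vcarrier X then \<phi> (ract X x a) else 0),
      ract = (\<lambda>\<phi> a x. if x \<in> vcarrier X then \<phi> (lact X a x) else 0)\<rparr>"

definition bounded_derivation :: "'a nalgebra \<Rightarrow> ('a, 'y) nbimodule \<Rightarrow> ('a \<Rightarrow> 'y) \<Rightarrow> bool" where
  "bounded_derivation A Y D \<longleftrightarrow>
     bounded_clinear_map A Y D \<and>
     (\<forall>a\<in>vcarrier A. \<forall>b\<in>vcarrier A.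
        D (amult A a b) = vadd Y (lact Y a (D b)) (ract Y (D a) b))"

definition inner_derivation :: "'a nalgebra \<Rightarrow> ('a, 'y) nbimodule \<Rightarrow> ('a \<Rightarrow> 'y) \<Rightarrow> bool" where
  "inner_derivation A Y D \<longleftrightarrow>
     (\<exists>y\<in>vcarrier Y. \<forall>a\<in>vcarrier A. D a = vminus Y (lact Y a y) (ract Y y a))"

text \<open>
  HOL cannot quantify over all types, so the bimodules range over all those whose carrier is a set
  of elements of type \<open>('a \<Rightarrow> 'a \<Rightarrow> complex) set\<close>, equivalently (transporting the structure
  along an injection) over all Banach bimodules of at most that cardinality.  This loses nothing:
  Johnson's construction of a virtual diagonal, from which every bounded derivation into every dual
  bimodule is inner, uses the hypothesis only for the predual modules \<open>A\<^sup>*\<close> and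
  \<open>(ker \<pi>)\<^sup>* = (A \<otimes> A)\<^sup>* / (ker \<pi>)\<^sup>\<bottom>\<close>, where \<open>A \<otimes> A\<close> is the projective tensor product and
  \<open>\<pi>\<close> the product map.  The elements of the latter are cosets of bounded bilinear forms
  on \<open>A\<close>, hence of the type above.
\<close>

definition amenable :: "'a nalgebra \<Rightarrow> bool" where
  "amenable A \<longleftrightarrow>
     (\<forall>(X :: ('a, ('a \<Rightarrow> 'a \<Rightarrow> complex) set) nbimodule) D.
        banach_bimodule A X \<longrightarrow> bounded_derivation A (dual_bimodule X) D \<longrightarrow>
        inner_derivation A (dual_bimodule X) D)"


section \<open>The hypergroup algebra\<close>

definition hypergroup_algebra :: "'h hypergroup_data \<Rightarrow> ('h \<Rightarrow> real) \<Rightarrow> ('h \<Rightarrow> complex) nalgebra" where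
  "hypergroup_algebra H \<mu> =
     \<lparr>vcarrier = Lp 1 \<mu>,
      vzero = (\<lambda>x. 0),
      vadd = (\<lambda>f g x. f x + g x),
      vscale = (\<lambda>c f x. c * f x),
      vnorm = Lp_norm 1 \<mu>,
      amult = (\<lambda>f g x. \<Sum>\<^sub>\<infinity>t. f t * ltrans H t g x * of_real (\<mu> t))\<rparr>"

end

theory Submission
  imports Defs
begin

text \<open>
  Suppose that \<open>\<lambda>\<close> tends to infinity.  A virtual diagonal of the unital algebra \<open>L\<^sup>1(H)\<close> is a bounded
  functional \<open>m\<close> on \<open>\<ell>\<^sup>\<infinity>(H \<times> H)\<close>, invariant under moving a translation from one variable to the other
  and satisfying \<open>m(\<Phi>\<^sub>h) = h(e)\<close> for \<open>\<Phi>\<^sub>h(z, y) = (\<delta>\<^sub>z * \<delta>\<^sub>y)(h)\<close>.  On \<open>c\<^sub>0(H \<times> H)\<close> it is summation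
  against some \<open>c \<in> \<ell>\<^sup>1(H \<times> H)\<close>.  Invariance gives \<open>C(x~) = \<lambda>(x) C(e)\<close> for the
  column sums \<open>C(y) = \<Sum>\<^sub>z c(z, y)\<close>, and as \<open>C\<close> is summable, \<open>\<lambda> \<ge> 1\<close> and \<open>H\<close> is infinite, \<open>C = 0\<close>.
  For the indicator \<open>h\<close> of a finite set \<open>G\<close>, the bound \<open>(\<delta>\<^sub>z * \<delta>\<^sub>y)(G) \<le> \<lambda>(G) / \<lambda>(y)\<close> puts \<open>\<Phi>\<^sub>h\<close> in
  \<open>c\<^sub>0(H \<times> H)\<close>, so \<open>\<Sum> c \<Phi>\<^sub>h = m(\<Phi>\<^sub>h) = 1\<close> as soon as \<open>e \<in> G\<close>.  But as \<open>G\<close> increases to \<open>H\<close>, dominated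
  convergence sends the left side to \<open>\<Sum>\<^sub>y C(y) = 0\<close>.
\<close>

section \<open>Banach spaces of functions\<close>

text \<open>Nonnegativity and symmetry are also needed off the carrier, since \<^locale>\<open>Metric_space\<close> demands them for all
  arguments.\<close>

lemma complex_banach_space_eval:
  fixes X :: "('x, 'm) nspace_scheme" and ev :: "'x \<Rightarrow> 'i \<Rightarrow> complex"
  assumes inj: "inj_on ev (vcarrier X)"
    and zero: "vzero X \<in> vcarrier X" "\<And>i. ev (vzero X) i = 0"
    and add: "\<And>x y. x \<in> vcarrier X \<Longrightarrow> y \<in> vcarrier X \<Longrightarrow> vadd X x y \<in> vcarrier X"
      "\<And>x y i. x \<in> vcarrier X \<Longrightarrow> y \<in> vcarrier X \<Longrightarrow> ev (vadd X x y) i = ev x i + ev y i"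
    and scale: "\<And>c x. x \<in> vcarrier X \<Longrightarrow> vscale X c x \<in> vcarrier X"
      "\<And>c x i. x \<in> vcarrier X \<Longrightarrow> ev (vscale X c x) i = c * ev x i"
    and nonneg: "\<And>x. 0 \<le> vnorm X x"
    and commute: "\<And>x y. vnorm X (vminus X x y) = vnorm X (vminus X y x)"
    and norm_scale: "\<And>c x. x \<in> vcarrier X \<Longrightarrow> vnorm X (vscale X c x) = cmod c * vnorm X x"
    and triangle: "\<And>x y. x \<in> vcarrier X \<Longrightarrow> y \<in> vcarrier X \<Longrightarrow> vnorm X (vadd X x y) \<le> vnorm X x + vnorm X y"
    and bound: "\<And>x i. x \<in> vcarrier X \<Longrightarrow> cmod (ev x i) \<le> C i * vnorm X x"
    and lim: "\<And>\<sigma> l. \<lbrakk>\<And>n. \<sigma> n \<in> vcarrier X;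
        \<And>e. e > 0 \<Longrightarrow> \<exists>N. \<forall>n\<ge>N. \<forall>m\<ge>n. vnorm X (vminus X (\<sigma> n) (\<sigma> m)) \<le> e;
        \<And>i. (\<lambda>n. ev (\<sigma> n) i) \<longlonglongrightarrow> l i\<rbrakk> \<Longrightarrow>
        \<exists>x\<in>vcarrier X. \<forall>n e. (\<forall>m\<ge>n. vnorm X (vminus X (\<sigma> n) (\<sigma> m)) \<le> e) \<longrightarrow> vnorm X (vminus X (\<sigma> n) x) \<le> e"
  shows "complex_banach_space X"
proof -
  \<comment> \<open>Injectivity of \<open>ev\<close> reduces each vector space law to the same law
    for complex numbers.\<close>
  have eqI: "x = y" if "x \<in> vcarrier X" "y \<in> vcarrier X" "\<And>i. ev x i = ev y i" for x y
    using inj that by (auto simp: inj_on_def fun_eq_iff)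
  have mc: "vminus X x y \<in> vcarrier X" if "x \<in> vcarrier X" "y \<in> vcarrier X" for x y
    using that by (simp add: vminus_def add scale)
  have me: "ev (vminus X x y) i = ev x i - ev y i" if "x \<in> vcarrier X" "y \<in> vcarrier X" for x y i
    using that by (simp add: vminus_def add scale)
  have n0: "vnorm X x = 0 \<longleftrightarrow> x = vzero X" if x: "x \<in> vcarrier X" for x
  proof
    assume "vnorm X x = 0"
    then have "cmod (ev x i) \<le> 0" for i using bound[OF x, of i] by simp
    then show "x = vzero X" by (intro eqI x zero) (simp add: zero)
  next
    have "vscale X 0 (vzero X) = vzero X" by (rule eqI) (auto simp: zero scale)
    then show "x = vzero X \<Longrightarrow> vnorm X x = 0"
      using norm_scale[OF zero(1), of 0] by simp
  qed
  interpret M: Metric_space "vcarrier X" "\<lambda>x y. vnorm X (vminus X x y)"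
  proof
    fix x y z assume xyz: "x \<in> vcarrier X" "y \<in> vcarrier X" "z \<in> vcarrier X"
    have "vminus X x z = vadd X (vminus X x y) (vminus X y z)"
      using xyz by (intro eqI) (simp_all add: mc me add)
    then show "vnorm X (vminus X x z) \<le> vnorm X (vminus X x y) + vnorm X (vminus X y z)"
      using triangle[OF mc[OF xyz(1,2)] mc[OF xyz(2,3)]] by simp
  next
    fix x y assume xy: "x \<in> vcarrier X" "y \<in> vcarrier X"
    have "vminus X x y = vzero X \<longleftrightarrow> x = y"
    proof
      assume *: "vminus X x y = vzero X"
      have "ev x i = ev y i" for i using me[OF xy, of i] by (simp add: * zero)
      then show "x = y" by (intro eqI xy)
    next
      show "x = y \<Longrightarrow> vminus X x y = vzero X"
        using xy by (intro eqI) (simp_all add: mc me zero)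
    qed
    then show "vnorm X (vminus X x y) = 0 \<longleftrightarrow> x = y"
      by (simp add: n0 mc xy)
  qed (fact nonneg, fact commute)
  have compl: "M.mcomplete"
    unfolding M.mcomplete_def
  proof (intro allI impI)
    fix \<sigma> assume "M.MCauchy \<sigma>"
    then have \<sigma>: "\<sigma> n \<in> vcarrier X"
      and cau: "\<And>e. e > 0 \<Longrightarrow> \<exists>N. \<forall>n n'. N \<le> n \<longrightarrow> N \<le> n' \<longrightarrow> vnorm X (vminus X (\<sigma> n) (\<sigma> n')) < e" for n
      by (auto simp: M.MCauchy_def)
    have "Cauchy (\<lambda>n. ev (\<sigma> n) i)" for i
    proof (rule metric_CauchyI)
      fix e :: real assume e: "e > 0"
      \<comment> \<open>\<open>C i\<close> need not be positive, and a positive constant is required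
        as a divisor.\<close>
      define c where "c = max (C i) 1"
      have c: "c > 0" "C i \<le> c" by (auto simp: c_def)
      obtain N where N: "\<And>n n'. N \<le> n \<Longrightarrow> N \<le> n' \<Longrightarrow> vnorm X (vminus X (\<sigma> n) (\<sigma> n')) < e / c"
        using cau[of "e / c"] e c by auto
      have "dist (ev (\<sigma> n) i) (ev (\<sigma> n') i) < e" if "N \<le> n" "N \<le> n'" for n n'
      proof -
        have "cmod (ev (\<sigma> n) i - ev (\<sigma> n') i) \<le> C i * vnorm X (vminus X (\<sigma> n) (\<sigma> n'))"
          using bound[OF mc[OF \<sigma> \<sigma>], of n n' i] by (simp add: me \<sigma>)
        also have "\<dots> \<le> c * vnorm X (vminus X (\<sigma> n) (\<sigma> n'))"
          by (intro mult_right_mono c nonneg)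
        also have "\<dots> < c * (e / c)"
          using c N[OF that] by (intro mult_strict_left_mono)
        finally show ?thesis using c by (simp add: dist_norm)
      qed
      then show "\<exists>N. \<forall>m\<ge>N. \<forall>n\<ge>N. dist (ev (\<sigma> m) i) (ev (\<sigma> n) i) < e" by blast
    qed
    then have "\<forall>i. \<exists>L. (\<lambda>n. ev (\<sigma> n) i) \<longlonglongrightarrow> L"
      by (auto intro: Cauchy_convergent simp flip: convergent_def)
    from choice[OF this]
    obtain l where l: "\<And>i. (\<lambda>n. ev (\<sigma> n) i) \<longlonglongrightarrow> l i" by blast
    have "\<exists>N. \<forall>n\<ge>N. \<forall>m\<ge>n. vnorm X (vminus X (\<sigma> n) (\<sigma> m)) \<le> e" if "e > 0" for e
      using cau[OF that] by (meson le_trans less_imp_le)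
    \<comment> \<open>\<open>lim\<close> supplies a carrier element whose distance from
      \<open>\<sigma> n\<close> inherits every bound that holds for all later terms; the Cauchy
      property with \<open>e / 2\<close> then gives convergence in norm.\<close>
    from lim[OF \<sigma> this l] obtain x where x: "x \<in> vcarrier X"
      "\<And>n e. (\<forall>m\<ge>n. vnorm X (vminus X (\<sigma> n) (\<sigma> m)) \<le> e) \<Longrightarrow> vnorm X (vminus X (\<sigma> n) x) \<le> e"
      by blast
    have "\<exists>N. \<forall>n\<ge>N. vnorm X (vminus X (\<sigma> n) x) < e" if e: "e > 0" for e
    proof -
      obtain N where N: "\<And>n n'. N \<le> n \<Longrightarrow> N \<le> n' \<Longrightarrow> vnorm X (vminus X (\<sigma> n) (\<sigma> n')) < e / 2"
        using cau[of "e/2"] e by auto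
      have "vnorm X (vminus X (\<sigma> n) x) < e" if "n \<ge> N" for n
        using x(2)[of n "e/2"] N[of n] that e by (smt (verit) field_sum_of_halves le_trans)
      then show ?thesis by blast
    qed
    then show "\<exists>x. limitin M.mtopology \<sigma> x sequentially"
      using x(1) \<sigma> by (auto simp: M.limit_metric_sequentially intro!: exI[of _ x])
  qed
  show ?thesis
  proof (unfold_locales, goal_cases)
    case 4 then show ?case by (intro eqI) (simp_all add: add)
  next
    case 5 then show ?case by (intro eqI) (simp_all add: add)
  next
    case 6 then show ?case by (intro eqI) (simp_all add: add zero)
  next
    case 7 then show ?case by (intro eqI) (simp_all add: mc me zero)
  next
    case 8 then show ?case by (intro eqI) (simp_all add: scale)
  next
    case 9 then show ?case by (intro eqI) (simp_all add: scale)
  next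
    case 10 then show ?case by (intro eqI) (simp_all add: add scale distrib_right)
  next
    case 11 then show ?case by (intro eqI) (simp_all add: add scale distrib_left)
  next
    case 13 then show ?case by (rule n0)
  qed (fact zero add scale nonneg norm_scale triangle compl | simp add: add scale norm_scale triangle nonneg)+
qed

section \<open>Bilinear forms and virtual diagonals\<close>

text \<open>A model of the dual of the projective tensor square of \<open>A\<close>. Values are zero
  off the carrier, so that each functional is a single HOL function.\<close>

definition bforms :: "('a, 'm) nalgebra_scheme \<Rightarrow> ('a \<Rightarrow> 'a \<Rightarrow> complex) set" where
  "bforms A = {\<phi>.
     (\<forall>a\<in>vcarrier A. \<forall>b\<in>vcarrier A. \<forall>c\<in>vcarrier A.
        \<phi> (vadd A a b) c = \<phi> a c + \<phi> b c \<and> \<phi> c (vadd A a b) = \<phi> c a + \<phi> c b) \<and>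
     (\<forall>k. \<forall>a\<in>vcarrier A. \<forall>b\<in>vcarrier A.
        \<phi> (vscale A k a) b = k * \<phi> a b \<and> \<phi> a (vscale A k b) = k * \<phi> a b) \<and>
     (\<exists>C\<ge>0. \<forall>a\<in>vcarrier A. \<forall>b\<in>vcarrier A. cmod (\<phi> a b) \<le> C * (vnorm A a * vnorm A b)) \<and>
     (\<forall>a b. a \<notin> vcarrier A \<or> b \<notin> vcarrier A \<longrightarrow> \<phi> a b = 0)}"

text \<open>The operator norm as the least admissible constant. The condition
  \<open>0 \<le> C\<close> keeps the set bounded below even when all norms in \<open>A\<close>
  vanish.\<close>

definition bform_norm :: "('a, 'm) nalgebra_scheme \<Rightarrow> ('a \<Rightarrow> 'a \<Rightarrow> complex) \<Rightarrow> real" where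
  "bform_norm A \<phi> =
     Inf {C. 0 \<le> C \<and> (\<forall>a\<in>vcarrier A. \<forall>b\<in>vcarrier A. cmod (\<phi> a b) \<le> C * (vnorm A a * vnorm A b))}"

text \<open>A form given by a formula is cut off here to meet the last clause of
  \<open>bforms\<close>.\<close>

definition restr2 :: "('a, 'm) nspace_scheme \<Rightarrow> ('a \<Rightarrow> 'a \<Rightarrow> complex) \<Rightarrow> 'a \<Rightarrow> 'a \<Rightarrow> complex" where
  "restr2 A \<phi> a b = (if a \<in> vcarrier A \<and> b \<in> vcarrier A then \<phi> a b else 0)"

lemma bform_norm_le:
  assumes "0 \<le> C" "\<And>a b. a \<in> vcarrier A \<Longrightarrow> b \<in> vcarrier A \<Longrightarrow> cmod (\<phi> a b) \<le> C * (vnorm A a * vnorm A b)"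
  shows "bform_norm A \<phi> \<le> C"
  unfolding bform_norm_def
  by (rule cInf_lower) (use assms in \<open>auto intro: bdd_belowI[of _ 0]\<close>)

lemma bforms_bound:
  assumes "\<phi> \<in> bforms A"
  obtains C where "0 \<le> C" "\<And>a b. a \<in> vcarrier A \<Longrightarrow> b \<in> vcarrier A \<Longrightarrow> cmod (\<phi> a b) \<le> C * (vnorm A a * vnorm A b)"
  using assms unfolding bforms_def by blast

lemma bform_norm_nonneg:
  assumes "\<phi> \<in> bforms A"
  shows "0 \<le> bform_norm A \<phi>"
proof -
  obtain C where "0 \<le> C" "\<And>a b. a \<in> vcarrier A \<Longrightarrow> b \<in> vcarrier A \<Longrightarrow> cmod (\<phi> a b) \<le> C * (vnorm A a * vnorm A b)"
    using bforms_bound[OF assms] by blast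
  then show ?thesis unfolding bform_norm_def by (intro cInf_greatest) auto
qed

section \<open>Operator norm and shifts of bilinear forms\<close>

context banach_algebra begin

lemma amult_closed: "a \<in> vcarrier A \<Longrightarrow> b \<in> vcarrier A \<Longrightarrow> amult A a b \<in> vcarrier A"
  using mult_linear_left[of b] by (auto simp: clinear_map_def)

lemma amult_linear:
  assumes "a \<in> vcarrier A" "b \<in> vcarrier A" "c \<in> vcarrier A"
  shows "amult A (vadd A a b) c = vadd A (amult A a c) (amult A b c)"
    "amult A c (vadd A a b) = vadd A (amult A c a) (amult A c b)"
    "amult A (vscale A k a) c = vscale A k (amult A a c)"
    "amult A c (vscale A k a) = vscale A k (amult A c a)"
  using mult_linear_left[of c] mult_linear_right[of c] assms by (auto simp: clinear_map_def)

text \<open>The infimum is attained. If the product of the norms is positive, dividing by it gives a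
  lower bound of the admissible constants; if it is zero, any admissible constant forces the value
  to be zero.\<close>

lemma bform_le_norm:
  assumes "\<phi> \<in> bforms A" "a \<in> vcarrier A" "b \<in> vcarrier A"
  shows "cmod (\<phi> a b) \<le> bform_norm A \<phi> * (vnorm A a * vnorm A b)"
proof (cases "vnorm A a * vnorm A b = 0")
  case True
  obtain C where "cmod (\<phi> a b) \<le> C * (vnorm A a * vnorm A b)"
    using bforms_bound[OF assms(1)] assms(2,3) by metis
  then show ?thesis using True by (simp only: mult_zero_right)
next
  case False
  then have pos: "vnorm A a * vnorm A b > 0"
    using norm_nonneg assms by (metis less_eq_real_def mult_nonneg_nonneg)
  obtain C where C: "0 \<le> C" "\<And>a b. a \<in> vcarrier A \<Longrightarrow> b \<in> vcarrier A \<Longrightarrow> cmod (\<phi> a b) \<le> C * (vnorm A a * vnorm A b)"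
    using bforms_bound[OF assms(1)] by blast
  have "cmod (\<phi> a b) / (vnorm A a * vnorm A b) \<le> bform_norm A \<phi>"
    unfolding bform_norm_def
    by (rule cInf_greatest) (use C pos assms in \<open>auto simp: divide_le_eq\<close>)
  then show ?thesis using pos by (simp add: divide_le_eq)
qed

lemma bforms_add: "\<phi> \<in> bforms A \<Longrightarrow> \<psi> \<in> bforms A \<Longrightarrow> (\<lambda>a b. \<phi> a b + \<psi> a b) \<in> bforms A"
proof -
  assume f: "\<phi> \<in> bforms A" "\<psi> \<in> bforms A"
  have "\<exists>C\<ge>0. \<forall>a\<in>vcarrier A. \<forall>b\<in>vcarrier A. cmod (\<phi> a b + \<psi> a b) \<le> C * (vnorm A a * vnorm A b)"
    by (rule exI[of _ "bform_norm A \<phi> + bform_norm A \<psi>"])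
      (use f in \<open>auto simp: bform_norm_nonneg distrib_right intro!: norm_triangle_mono bform_le_norm\<close>)
  then show ?thesis using f unfolding bforms_def by (simp add: algebra_simps)
qed

lemma bforms_scale: "\<phi> \<in> bforms A \<Longrightarrow> (\<lambda>a b. k * \<phi> a b) \<in> bforms A"
proof -
  assume f: "\<phi> \<in> bforms A"
  have "\<exists>C\<ge>0. \<forall>a\<in>vcarrier A. \<forall>b\<in>vcarrier A. cmod (k * \<phi> a b) \<le> C * (vnorm A a * vnorm A b)"
    by (rule exI[of _ "cmod k * bform_norm A \<phi>"])
      (use f in \<open>auto simp: bform_norm_nonneg Real_Vector_Spaces.norm_mult mult.assoc intro!: mult_left_mono bform_le_norm\<close>)
  then show ?thesis using f unfolding bforms_def by (simp add: algebra_simps)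
qed

lemma bforms_zero: "(\<lambda>a b. 0) \<in> bforms A"
  unfolding bforms_def by (auto intro: exI[of _ 0])

lemma bforms_diff: "\<phi> \<in> bforms A \<Longrightarrow> \<psi> \<in> bforms A \<Longrightarrow> (\<lambda>a b. \<phi> a b - \<psi> a b) \<in> bforms A"
  using bforms_add[of \<phi> "\<lambda>a b. -1 * \<psi> a b"] bforms_scale[of \<psi> "-1"] by simp

lemma bforms_lin:
  assumes "\<phi> \<in> bforms A"
  shows "a \<in> vcarrier A \<Longrightarrow> b \<in> vcarrier A \<Longrightarrow> c \<in> vcarrier A \<Longrightarrow> \<phi> (vadd A a b) c = \<phi> a c + \<phi> b c"
    "a \<in> vcarrier A \<Longrightarrow> b \<in> vcarrier A \<Longrightarrow> c \<in> vcarrier A \<Longrightarrow> \<phi> c (vadd A a b) = \<phi> c a + \<phi> c b"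
    "a \<in> vcarrier A \<Longrightarrow> b \<in> vcarrier A \<Longrightarrow> \<phi> (vscale A k a) b = k * \<phi> a b"
    "a \<in> vcarrier A \<Longrightarrow> b \<in> vcarrier A \<Longrightarrow> \<phi> a (vscale A k b) = k * \<phi> a b"
  using assms unfolding bforms_def by simp_all

lemma restr2_bforms:
  assumes "\<And>a b c. a \<in> vcarrier A \<Longrightarrow> b \<in> vcarrier A \<Longrightarrow> c \<in> vcarrier A \<Longrightarrow> \<phi> (vadd A a b) c = \<phi> a c + \<phi> b c"
    "\<And>a b c. a \<in> vcarrier A \<Longrightarrow> b \<in> vcarrier A \<Longrightarrow> c \<in> vcarrier A \<Longrightarrow> \<phi> c (vadd A a b) = \<phi> c a + \<phi> c b"
    "\<And>k a b. a \<in> vcarrier A \<Longrightarrow> b \<in> vcarrier A \<Longrightarrow> \<phi> (vscale A k a) b = k * \<phi> a b"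
    "\<And>k a b. a \<in> vcarrier A \<Longrightarrow> b \<in> vcarrier A \<Longrightarrow> \<phi> a (vscale A k b) = k * \<phi> a b"
    "0 \<le> C" "\<And>a b. a \<in> vcarrier A \<Longrightarrow> b \<in> vcarrier A \<Longrightarrow> cmod (\<phi> a b) \<le> C * (vnorm A a * vnorm A b)"
  shows "restr2 A \<phi> \<in> bforms A"
proof -
  have "\<exists>C\<ge>0. \<forall>a\<in>vcarrier A. \<forall>b\<in>vcarrier A. cmod (restr2 A \<phi> a b) \<le> C * (vnorm A a * vnorm A b)"
    using assms(5,6) by (intro exI[of _ C]) (simp add: restr2_def)
  then show ?thesis
    unfolding bforms_def mem_Collect_eq
    using assms(1-4) by (simp add: restr2_def add_closed scale_closed)
qed

lemma bforms_out: "\<phi> \<in> bforms A \<Longrightarrow> a \<notin> vcarrier A \<or> b \<notin> vcarrier A \<Longrightarrow> \<phi> a b = 0"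
  unfolding bforms_def by blast

text \<open>The shifts are the transposes of the maps sending \<open>b \<otimes> c\<close> to
  \<open>ab \<otimes> c\<close>, \<open>b \<otimes> ca\<close> and \<open>a \<otimes> bc\<close>.
  The first two are the module actions on forms; the third is the correction that keeps the right
  action inside the kernel forms. Submultiplicativity bounds all three by
  \<open>vnorm A a\<close>.\<close>

lemma
  assumes f: "\<phi> \<in> bforms A" and a: "a \<in> vcarrier A"
  shows bforms_shift_left: "restr2 A (\<lambda>b c. \<phi> (amult A a b) c) \<in> bforms A" (is ?t1)
    and bform_norm_shift_left: "bform_norm A (restr2 A (\<lambda>b c. \<phi> (amult A a b) c)) \<le> bform_norm A \<phi> * vnorm A a" (is ?t2)
    and bforms_shift_right: "restr2 A (\<lambda>b c. \<phi> b (amult A c a)) \<in> bforms A" (is ?t3)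
    and bform_norm_shift_right: "bform_norm A (restr2 A (\<lambda>b c. \<phi> b (amult A c a))) \<le> bform_norm A \<phi> * vnorm A a" (is ?t4)
    and bforms_shift_mid: "restr2 A (\<lambda>b c. \<phi> a (amult A b c)) \<in> bforms A" (is ?t5)
    and bform_norm_shift_mid: "bform_norm A (restr2 A (\<lambda>b c. \<phi> a (amult A b c))) \<le> bform_norm A \<phi> * vnorm A a" (is ?t6)
proof -
  let ?C = "bform_norm A \<phi> * vnorm A a"
  have C: "?C \<ge> 0" using f a by (simp add: bform_norm_nonneg norm_nonneg)
  have 1: "cmod (\<phi> (amult A a b) c) \<le> ?C * (vnorm A b * vnorm A c)"
    if "b \<in> vcarrier A" "c \<in> vcarrier A" for b c
  proof -
    have "cmod (\<phi> (amult A a b) c) \<le> bform_norm A \<phi> * (vnorm A (amult A a b) * vnorm A c)"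
      using f a that by (intro bform_le_norm amult_closed)
    also have "\<dots> \<le> bform_norm A \<phi> * ((vnorm A a * vnorm A b) * vnorm A c)"
      using f a that by (intro mult_left_mono mult_right_mono norm_mult norm_nonneg bform_norm_nonneg)
    finally show ?thesis by (simp add: mult_ac)
  qed
  have 2: "cmod (\<phi> b (amult A c a)) \<le> ?C * (vnorm A b * vnorm A c)"
    if "b \<in> vcarrier A" "c \<in> vcarrier A" for b c
  proof -
    have "cmod (\<phi> b (amult A c a)) \<le> bform_norm A \<phi> * (vnorm A b * vnorm A (amult A c a))"
      using f a that by (intro bform_le_norm amult_closed)
    also have "\<dots> \<le> bform_norm A \<phi> * (vnorm A b * (vnorm A c * vnorm A a))"
      using f a that by (intro mult_left_mono mult_right_mono norm_mult norm_nonneg bform_norm_nonneg)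
    finally show ?thesis by (simp add: mult_ac)
  qed
  have 3: "cmod (\<phi> a (amult A b c)) \<le> ?C * (vnorm A b * vnorm A c)"
    if "b \<in> vcarrier A" "c \<in> vcarrier A" for b c
  proof -
    have "cmod (\<phi> a (amult A b c)) \<le> bform_norm A \<phi> * (vnorm A a * vnorm A (amult A b c))"
      using f a that by (intro bform_le_norm amult_closed)
    also have "\<dots> \<le> bform_norm A \<phi> * (vnorm A a * (vnorm A b * vnorm A c))"
      using f a that by (intro mult_left_mono mult_right_mono norm_mult norm_nonneg bform_norm_nonneg)
    finally show ?thesis by (simp add: mult_ac)
  qed
  show ?t2 ?t4 ?t6
    by (rule bform_norm_le[OF C]; simp add: restr2_def 1 2 3)+
  show ?t1
    by (rule restr2_bforms[OF _ _ _ _ C 1]) (simp_all add: f a amult_linear amult_closed bforms_lin)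
  show ?t3
    by (rule restr2_bforms[OF _ _ _ _ C 2]) (simp_all add: f a amult_linear amult_closed bforms_lin)
  show ?t5
    by (rule restr2_bforms[OF _ _ _ _ C 3]) (simp_all add: f a amult_linear amult_closed bforms_lin)
qed

lemma bform_norm_add:
  assumes "\<phi> \<in> bforms A" "\<psi> \<in> bforms A"
  shows "bform_norm A (\<lambda>a b. \<phi> a b + \<psi> a b) \<le> bform_norm A \<phi> + bform_norm A \<psi>"
  using assms
  by (intro bform_norm_le add_nonneg_nonneg bform_norm_nonneg; simp add: distrib_right)
    (intro norm_triangle_mono bform_le_norm; assumption)

lemma bform_norm_scale:
  assumes "\<phi> \<in> bforms A"
  shows "bform_norm A (\<lambda>a b. k * \<phi> a b) = cmod k * bform_norm A \<phi>"
proof -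
  have le: "bform_norm A (\<lambda>a b. k * \<psi> a b) \<le> cmod k * bform_norm A \<psi>" if "\<psi> \<in> bforms A" for k \<psi>
    using that
    by (intro bform_norm_le mult_nonneg_nonneg bform_norm_nonneg)
      (simp_all add: Real_Vector_Spaces.norm_mult mult.assoc mult_left_mono bform_le_norm)
  show ?thesis
  proof (cases "k = 0")
    case True
    then show ?thesis using le[OF assms, of k] bform_norm_nonneg[OF bforms_scale[OF assms, of k]] by simp
  next
    case False
    \<comment> \<open>The reverse inequality is \<open>le\<close> for the form
      \<open>k * \<phi>\<close> and the factor \<open>1 / k\<close>.\<close>
    then have "bform_norm A \<phi> \<le> cmod (1 / k) * bform_norm A (\<lambda>a b. k * \<phi> a b)"
      using le[OF bforms_scale[OF assms, of k], of "1 / k"] by simp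
    then show ?thesis using le[OF assms, of k] False by (simp add: norm_divide field_simps)
  qed
qed

end

section \<open>The kernel of the product map and the virtual diagonal\<close>

locale unital_banach_algebra = banach_algebra A for A :: "'a nalgebra" +
  fixes u :: 'a
  assumes unit_closed: "u \<in> vcarrier A"
    and unit_left: "a \<in> vcarrier A \<Longrightarrow> amult A u a = a"
    and unit_right: "a \<in> vcarrier A \<Longrightarrow> amult A a u = a"
begin

definition kernel_forms :: "('a \<Rightarrow> 'a \<Rightarrow> complex) set" where
  "kernel_forms = {\<phi> \<in> bforms A. \<forall>c. \<phi> u c = 0}"

text \<open>
  The dual of the kernel of the product map \<open>\<pi> : A \<otimes> A \<rightarrow> A\<close>: as \<open>u \<otimes> A\<close> is a complement of \<open>ker \<pi>\<close>, functionals
  on \<open>ker \<pi>\<close> are the bounded forms vanishing on \<open>u \<otimes> A\<close>; the second term of the right action projects back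
  onto these.  Forms are wrapped in singletons because \<^const>\<open>amenable\<close> only quantifies over bimodules with that element
  type.  The absolute value matters only off the carrier, where \<^const>\<open>bform_norm\<close> may be the infimum of the empty set.
\<close>

definition kernel_dual :: "('a, ('a \<Rightarrow> 'a \<Rightarrow> complex) set) nbimodule" where
  "kernel_dual =
     \<lparr>vcarrier = (\<lambda>\<phi>. {\<phi>}) ` kernel_forms,
      vzero = {\<lambda>a b. 0},
      vadd = (\<lambda>P Q. {\<lambda>a b. the_elem P a b + the_elem Q a b}),
      vscale = (\<lambda>k P. {\<lambda>a b. k * the_elem P a b}),
      vnorm = (\<lambda>P. \<bar>bform_norm A (the_elem P)\<bar>),
      lact = (\<lambda>a P. {restr2 A (\<lambda>b c. the_elem P b (amult A c a))}),
      ract = (\<lambda>P a. {restr2 A (\<lambda>b c. the_elem P (amult A a b) c - the_elem P a (amult A b c))})\<rparr>"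

lemma kernel_dual_simps [simp]:
  "vcarrier kernel_dual = (\<lambda>\<phi>. {\<phi>}) ` kernel_forms"
  "vzero kernel_dual = {\<lambda>a b. 0}"
  "vadd kernel_dual P Q = {\<lambda>a b. the_elem P a b + the_elem Q a b}"
  "vscale kernel_dual k P = {\<lambda>a b. k * the_elem P a b}"
  "vnorm kernel_dual P = \<bar>bform_norm A (the_elem P)\<bar>"
  "lact kernel_dual a P = {restr2 A (\<lambda>b c. the_elem P b (amult A c a))}"
  "ract kernel_dual P a = {restr2 A (\<lambda>b c. the_elem P (amult A a b) c - the_elem P a (amult A b c))}"
  by (simp_all add: kernel_dual_def)

lemma vminus_kernel_dual [simp]:
  "vminus kernel_dual P Q = {\<lambda>a b. the_elem P a b - the_elem Q a b}"
  by (simp add: vminus_def)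

lemma kernel_forms_bform: "\<phi> \<in> kernel_forms \<Longrightarrow> \<phi> \<in> bforms A"
  by (simp add: kernel_forms_def)

lemma kernel_forms_add: "\<phi> \<in> kernel_forms \<Longrightarrow> \<psi> \<in> kernel_forms \<Longrightarrow> (\<lambda>a b. \<phi> a b + \<psi> a b) \<in> kernel_forms"
  by (simp add: kernel_forms_def bforms_add)

lemma kernel_forms_scale: "\<phi> \<in> kernel_forms \<Longrightarrow> (\<lambda>a b. k * \<phi> a b) \<in> kernel_forms"
  by (simp add: kernel_forms_def bforms_scale)

text \<open>The algebraic conditions pass to pointwise limits. Boundedness comes from comparison
  with one form: all later forms are within 1 of \<open>\<phi> N\<close>, so
  \<open>bform_norm A (\<phi> N) + 1\<close> bounds the limit.\<close>

lemma kernel_forms_lim: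
  assumes \<phi>: "\<And>n. \<phi> n \<in> kernel_forms"
    and cau: "\<And>m. N \<le> m \<Longrightarrow> bform_norm A (\<lambda>a b. \<phi> N a b - \<phi> m a b) \<le> 1"
    and l: "\<And>a b. (\<lambda>n. \<phi> n a b) \<longlonglongrightarrow> l a b"
  shows "l \<in> kernel_forms"
proof -
  note b = kernel_forms_bform[OF \<phi>]
  have bound: "cmod (l a b) \<le> (bform_norm A (\<phi> N) + 1) * (vnorm A a * vnorm A b)"
    if ab: "a \<in> vcarrier A" "b \<in> vcarrier A" for a b
  proof (rule tendsto_upperbound[OF tendsto_norm[OF l]])
    have "cmod (\<phi> m a b) \<le> (bform_norm A (\<phi> N) + 1) * (vnorm A a * vnorm A b)" if "N \<le> m" for m
    proof -
      have 0: "0 \<le> vnorm A a * vnorm A b" by (intro mult_nonneg_nonneg norm_nonneg ab)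
      have "cmod (\<phi> N a b - \<phi> m a b) \<le> bform_norm A (\<lambda>a b. \<phi> N a b - \<phi> m a b) * (vnorm A a * vnorm A b)"
        using bform_le_norm[OF bforms_diff[OF b b] ab] .
      also have "\<dots> \<le> 1 * (vnorm A a * vnorm A b)"
        using cau[OF that] 0 by (rule mult_right_mono)
      finally have 1: "cmod (\<phi> N a b - \<phi> m a b) \<le> vnorm A a * vnorm A b" by simp
      have "cmod (\<phi> m a b) \<le> cmod (\<phi> N a b) + cmod (\<phi> N a b - \<phi> m a b)"
        by (metis norm_minus_commute norm_triangle_sub add.commute)
      then show ?thesis using 1 bform_le_norm[OF b ab, of N] by (simp add: distrib_right)
    qed
    then show "\<forall>\<^sub>F m in sequentially. cmod (\<phi> m a b) \<le> (bform_norm A (\<phi> N) + 1) * (vnorm A a * vnorm A b)"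
      by (auto simp: eventually_sequentially)
  qed simp
  have uniq: "l a b = L" if "(\<lambda>n. \<phi> n a b) \<longlonglongrightarrow> L" for a b L
    using LIMSEQ_unique[OF l that] .
  have out: "l a b = 0" if "a \<notin> vcarrier A \<or> b \<notin> vcarrier A" for a b
    by (rule uniq) (use that in \<open>simp add: bforms_out[OF b]\<close>)
  have "restr2 A l \<in> bforms A"
  proof (rule restr2_bforms[OF _ _ _ _ _ bound])
    show "0 \<le> bform_norm A (\<phi> N) + 1" using bform_norm_nonneg[OF b] by (simp add: add_nonneg_nonneg)
  qed (auto intro!: uniq tendsto_intros l simp: bforms_lin[OF b])
  moreover have "restr2 A l = l" using out by (auto simp: restr2_def fun_eq_iff)
  moreover have "l u c = 0" for c
    by (rule uniq) (use \<phi> in \<open>simp add: kernel_forms_def\<close>)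
  ultimately show ?thesis by (simp add: kernel_forms_def)
qed

lemma kernel_dual_banach: "complex_banach_space kernel_dual"
\<comment> \<open>A form is evaluated at pairs. Off the carrier of \<open>A\<close> the norm is
  unspecified, and the absolute value keeps the constant nonnegative where the form is zero.\<close>
proof (rule complex_banach_space_eval[where ev = "\<lambda>P (a, b). the_elem P a b"
      and C = "\<lambda>(a, b). \<bar>vnorm A a * vnorm A b\<bar>"], goal_cases)
  case 1
  then show ?case by (auto simp: inj_on_def fun_eq_iff)
next
  case 2
  then show ?case by (auto simp: kernel_forms_def bforms_zero)
next
  case (9 P Q)
  have "bform_norm A (\<lambda>a b. the_elem P a b - the_elem Q a b) = bform_norm A (\<lambda>a b. the_elem Q a b - the_elem P a b)"
    unfolding bform_norm_def by (simp add: norm_minus_commute)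
  then show ?case by simp
next
  case (10 c P)
  then show ?case by (auto simp: bform_norm_scale kernel_forms_bform abs_mult)
next
  case (11 P Q)
  then obtain \<phi> \<psi> where "P = {\<phi>}" "Q = {\<psi>}" "\<phi> \<in> bforms A" "\<psi> \<in> bforms A"
    by (auto dest: kernel_forms_bform)
  then show ?case
    using bform_norm_add[of \<phi> \<psi>] bform_norm_nonneg[of _ A] bforms_add[of \<phi> \<psi>] by simp
next
  case (12 P i)
  then obtain \<phi> a b where \<phi>: "P = {\<phi>}" "\<phi> \<in> bforms A" "i = (a, b)"
    by (cases i) (auto dest: kernel_forms_bform)
  show ?case
  proof (cases "a \<in> vcarrier A \<and> b \<in> vcarrier A")
    case True
    then show ?thesis using bform_le_norm[OF \<phi>(2), of a b] \<phi>
      by (simp add: bform_norm_nonneg norm_nonneg mult.commute)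
  next
    case False
    then have "\<phi> a b = 0" using bforms_out[OF \<phi>(2)] by blast
    then show ?thesis by (simp add: \<phi>(1,3))
  qed
next
  case (13 \<sigma> l)
  define \<phi> where "\<phi> n = the_elem (\<sigma> n)" for n
  have \<phi>: "\<phi> n \<in> kernel_forms" "\<sigma> n = {\<phi> n}" for n
  proof -
    obtain f where "\<sigma> n = {f}" "f \<in> kernel_forms" using 13(1)[of n] by auto
    then show "\<phi> n \<in> kernel_forms" "\<sigma> n = {\<phi> n}" by (simp_all add: \<phi>_def)
  qed
  define l' where "l' a b = l (a, b)" for a b
  have l': "(\<lambda>n. \<phi> n a b) \<longlonglongrightarrow> l' a b" for a b
    using 13(3)[of "(a, b)"] by (simp add: \<phi>(2) l'_def)
  obtain N where "\<And>m. N \<le> m \<Longrightarrow> bform_norm A (\<lambda>a b. \<phi> N a b - \<phi> m a b) \<le> 1"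
    using 13(2)[of 1] by (simp add: \<phi>(2)) (meson abs_le_D1 order_refl)
  from kernel_forms_lim[OF \<phi>(1) this l'] have lk: "l' \<in> kernel_forms" .
  \<comment> \<open>The norm bound is read as an estimate at each pair \<open>a\<close>,
    \<open>b\<close>, passed to the limit there, and turned back into a norm bound.\<close>
  have "\<bar>bform_norm A (\<lambda>a b. \<phi> n a b - l' a b)\<bar> \<le> e"
    if e: "\<And>m. n \<le> m \<Longrightarrow> \<bar>bform_norm A (\<lambda>a b. \<phi> n a b - \<phi> m a b)\<bar> \<le> e" for n e
  proof -
    have "bform_norm A (\<lambda>a b. \<phi> n a b - l' a b) \<le> e"
    proof (rule bform_norm_le)
      show "0 \<le> e" using e[of n] by linarith
      fix a b assume ab: "a \<in> vcarrier A" "b \<in> vcarrier A"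
      have "cmod (\<phi> n a b - \<phi> m a b) \<le> e * (vnorm A a * vnorm A b)" if "n \<le> m" for m
      proof -
        have "cmod (\<phi> n a b - \<phi> m a b) \<le> bform_norm A (\<lambda>a b. \<phi> n a b - \<phi> m a b) * (vnorm A a * vnorm A b)"
          using bform_le_norm[OF bforms_diff ab] \<phi>(1) kernel_forms_bform by blast
        also have "\<dots> \<le> e * (vnorm A a * vnorm A b)"
          using e[OF that] by (intro mult_right_mono mult_nonneg_nonneg norm_nonneg ab) linarith
        finally show ?thesis .
      qed
      then show "cmod (\<phi> n a b - l' a b) \<le> e * (vnorm A a * vnorm A b)"
        by (intro tendsto_upperbound[OF tendsto_norm[OF tendsto_diff[OF tendsto_const l']]])
          (auto simp: eventually_sequentially)
    qed
    moreover have "0 \<le> bform_norm A (\<lambda>a b. \<phi> n a b - l' a b)"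
      by (intro bform_norm_nonneg bforms_diff kernel_forms_bform \<phi> lk)
    ultimately show ?thesis by simp
  qed
  then show ?case
    using lk by (intro bexI[of _ "{l'}"]) (auto simp: \<phi>(2))
qed (auto intro: kernel_forms_add kernel_forms_scale)

text \<open>The right action stays in the kernel forms because for \<open>b = u\<close> its two
  terms both equal \<open>\<phi> a c\<close> and cancel. These two terms also account for the factor
  2.\<close>

lemma
  assumes \<phi>: "\<phi> \<in> kernel_forms" and a: "a \<in> vcarrier A"
  shows lact_closed: "restr2 A (\<lambda>b c. \<phi> b (amult A c a)) \<in> kernel_forms"
    and ract_closed: "restr2 A (\<lambda>b c. \<phi> (amult A a b) c - \<phi> a (amult A b c)) \<in> kernel_forms"
    and lact_norm: "bform_norm A (restr2 A (\<lambda>b c. \<phi> b (amult A c a))) \<le> bform_norm A \<phi> * vnorm A a"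
    and ract_norm: "bform_norm A (restr2 A (\<lambda>b c. \<phi> (amult A a b) c - \<phi> a (amult A b c))) \<le> 2 * bform_norm A \<phi> * vnorm A a"
proof -
  note b = kernel_forms_bform[OF \<phi>]
  have eq: "restr2 A (\<lambda>b c. \<phi> (amult A a b) c - \<phi> a (amult A b c)) =
    (\<lambda>b c. restr2 A (\<lambda>b c. \<phi> (amult A a b) c) b c + -1 * restr2 A (\<lambda>b c. \<phi> a (amult A b c)) b c)"
    by (auto simp: restr2_def fun_eq_iff)
  show "restr2 A (\<lambda>b c. \<phi> b (amult A c a)) \<in> kernel_forms"
    using bforms_shift_right[OF b a] \<phi> by (simp add: kernel_forms_def restr2_def)
  show "restr2 A (\<lambda>b c. \<phi> (amult A a b) c - \<phi> a (amult A b c)) \<in> kernel_forms"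
    unfolding kernel_forms_def mem_Collect_eq
  proof
    show "restr2 A (\<lambda>b c. \<phi> (amult A a b) c - \<phi> a (amult A b c)) \<in> bforms A"
      unfolding eq by (intro bforms_add bforms_scale bforms_shift_left bforms_shift_mid b a)
  qed (simp add: restr2_def unit_left unit_right a)
  show "bform_norm A (restr2 A (\<lambda>b c. \<phi> b (amult A c a))) \<le> bform_norm A \<phi> * vnorm A a"
    by (rule bform_norm_shift_right[OF b a])
  have "bform_norm A (restr2 A (\<lambda>b c. \<phi> (amult A a b) c - \<phi> a (amult A b c))) \<le>
     bform_norm A (restr2 A (\<lambda>b c. \<phi> (amult A a b) c)) + bform_norm A (\<lambda>b c. -1 * restr2 A (\<lambda>b c. \<phi> a (amult A b c)) b c)"
    unfolding eq by (intro bform_norm_add bforms_scale bforms_shift_left bforms_shift_mid b a)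
  also have "\<dots> \<le> bform_norm A \<phi> * vnorm A a + bform_norm A \<phi> * vnorm A a"
    unfolding bform_norm_scale[OF bforms_shift_mid[OF b a]]
    using bform_norm_shift_left[OF b a] bform_norm_shift_mid[OF b a] by (intro add_mono) simp_all
  finally show "bform_norm A (restr2 A (\<lambda>b c. \<phi> (amult A a b) c - \<phi> a (amult A b c))) \<le> 2 * bform_norm A \<phi> * vnorm A a"
    by (simp add: mult_ac)
qed

lemma kernel_dual_bimodule: "banach_bimodule A kernel_dual"
proof -
  interpret X: complex_banach_space kernel_dual by (rule kernel_dual_banach)
  show ?thesis
  proof (unfold_locales, goal_cases)
    case (1 a)
    then show ?case unfolding clinear_map_def
      by (auto simp: lact_closed restr2_def fun_eq_iff)
  next
    case (2 P)
    then show ?case unfolding clinear_map_def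
      by (auto simp: lact_closed restr2_def fun_eq_iff amult_linear amult_closed
        bforms_lin[OF kernel_forms_bform])
  next
    case (3 a)
    then show ?case unfolding clinear_map_def
      by (auto simp: ract_closed restr2_def fun_eq_iff algebra_simps)
  next
    case (4 P)
    then show ?case unfolding clinear_map_def
      by (auto simp: ract_closed restr2_def fun_eq_iff amult_linear amult_closed
        bforms_lin[OF kernel_forms_bform] algebra_simps)
  next
    case (5 a b P)
    then show ?case
      by (auto simp: restr2_def fun_eq_iff amult_closed mult_assoc)
  next
    case (6 a b P)
    then show ?case
      by (auto simp: restr2_def fun_eq_iff amult_closed mult_assoc)
  next
    case (7 a b P)
    then show ?case
      by (auto simp: restr2_def fun_eq_iff amult_closed mult_assoc)
  next
    case 8
    have "vnorm kernel_dual (lact kernel_dual a P) \<le> 2 * vnorm A a * vnorm kernel_dual P \<and>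
      vnorm kernel_dual (ract kernel_dual P a) \<le> 2 * vnorm A a * vnorm kernel_dual P"
      if a: "a \<in> vcarrier A" and P: "P \<in> vcarrier kernel_dual" for a P
    proof -
      obtain \<phi> where \<phi>: "P = {\<phi>}" "\<phi> \<in> kernel_forms" using P by auto
      note closed = lact_closed[OF \<phi>(2) a] ract_closed[OF \<phi>(2) a] \<phi>(2)
      have "0 \<le> bform_norm A \<phi> * vnorm A a"
        by (intro mult_nonneg_nonneg bform_norm_nonneg kernel_forms_bform \<phi> norm_nonneg a)
      then show ?thesis
        using lact_norm[OF \<phi>(2) a] ract_norm[OF \<phi>(2) a] closed[THEN kernel_forms_bform, THEN bform_norm_nonneg]
        by (simp add: \<phi>(1) mult_ac)
    qed
    then show ?case by blast
  qed
qed

text \<open>This is the derivation \<open>a \<mapsto> a \<otimes> u - u \<otimes> a\<close>, with values in the bidual of \<open>ker \<pi>\<close>.\<close>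

lemma kernel_dual_derivation:
  "bounded_derivation A (dual_bimodule kernel_dual)
     (\<lambda>a P. if P \<in> vcarrier kernel_dual then the_elem P a u else 0)" (is "bounded_derivation _ _ ?D")
proof -
  note dual_bimodule_def [simp]
  have D_bound: "cmod (?D a P) \<le> vnorm A u * vnorm A a * vnorm kernel_dual P" if a: "a \<in> vcarrier A" and P: "P \<in> vcarrier kernel_dual" for a P
  proof -
    obtain \<phi> where \<phi>: "P = {\<phi>}" "\<phi> \<in> kernel_forms" using P by auto
    then show ?thesis
      using bform_le_norm[OF kernel_forms_bform[OF \<phi>(2)] a unit_closed] bform_norm_nonneg[OF kernel_forms_bform[OF \<phi>(2)]]
      by (simp add: mult_ac)
  qed
  have 1: "?D a \<in> vcarrier (dual_bimodule kernel_dual)" if "a \<in> vcarrier A" for a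
  proof -
    have "clinear_map kernel_dual complex_space (?D a)"
      by (auto simp: clinear_map_def complex_space_def kernel_forms_add kernel_forms_scale)
    moreover have "\<exists>C. \<forall>P\<in>vcarrier kernel_dual. vnorm complex_space (?D a P) \<le> C * vnorm kernel_dual P"
      using D_bound[OF that] by (intro exI[of _ "vnorm A u * vnorm A a"] ballI) (simp only: complex_space_def nspace.simps)
    ultimately show ?thesis by (simp add: bounded_clinear_map_def del: kernel_dual_simps)
  qed
  have 2: "clinear_map A (dual_bimodule kernel_dual) ?D"
    unfolding clinear_map_def
  proof (intro conjI ballI allI)
    show "?D a \<in> vcarrier (dual_bimodule kernel_dual)" if "a \<in> vcarrier A" for a using 1[OF that] .
  qed (auto simp: fun_eq_iff bforms_lin[OF kernel_forms_bform] unit_closed)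
  have 3: "vnorm (dual_bimodule kernel_dual) (?D a) \<le> vnorm A u * vnorm A a" if a: "a \<in> vcarrier A" for a
  proof -
    have ne: "{P \<in> vcarrier kernel_dual. vnorm kernel_dual P \<le> 1} \<noteq> {}"
    proof -
      have "bform_norm A (\<lambda>a b. 0 * 0) = 0"
        using bform_norm_scale[OF bforms_zero, of 0] by simp
      then have "{\<lambda>a b. 0} \<in> {P \<in> vcarrier kernel_dual. vnorm kernel_dual P \<le> 1}"
        by (auto simp: kernel_forms_def bforms_zero)
      then show ?thesis by blast
    qed
    have "(SUP P\<in>{P \<in> vcarrier kernel_dual. vnorm kernel_dual P \<le> 1}. cmod (?D a P)) \<le> vnorm A u * vnorm A a"
    proof (rule cSUP_least[OF ne])
      fix P assume P: "P \<in> {P \<in> vcarrier kernel_dual. vnorm kernel_dual P \<le> 1}"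
      then have "cmod (?D a P) \<le> vnorm A u * vnorm A a * vnorm kernel_dual P" using D_bound[OF a] by blast
      also have "\<dots> \<le> vnorm A u * vnorm A a * 1"
        using P a by (intro mult_left_mono mult_nonneg_nonneg norm_nonneg unit_closed) auto
      finally show "cmod (?D a P) \<le> vnorm A u * vnorm A a" by simp
    qed
    then show ?thesis by (simp del: kernel_dual_simps)
  qed
  \<comment> \<open>On a form \<open>\<phi>\<close> the two terms on the right are
    \<open>\<phi> (ab) u - \<phi> a b\<close> and \<open>\<phi> a b\<close>; the subtracted part is
    the projection in the right action.\<close>
  have 4: "?D (amult A a b) = vadd (dual_bimodule kernel_dual) (lact (dual_bimodule kernel_dual) a (?D b)) (ract (dual_bimodule kernel_dual) (?D a) b)"
    if "a \<in> vcarrier A" "b \<in> vcarrier A" for a b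
    using that
    by (auto simp: fun_eq_iff lact_closed ract_closed) (simp_all add: restr2_def unit_closed unit_left unit_right)
  show ?thesis
    unfolding bounded_derivation_def bounded_clinear_map_def
    using 2 3 4 by blast
qed

text \<open>Johnson's argument. If \<open>N\<close> in the bidual of \<open>ker \<pi>\<close>
  implements the derivation \<open>a \<otimes> u - u \<otimes> a\<close>, then
  \<open>u \<otimes> u - N\<close> commutes with \<open>A\<close>, and its image under the product
  is \<open>u\<close> since \<open>N\<close> lives on \<open>ker \<pi>\<close>. The last two
  properties express these facts in terms of forms.\<close>

lemma virtual_diagonal:
  assumes "amenable A"
  obtains M K where
    "\<And>\<phi> \<psi>. \<phi> \<in> bforms A \<Longrightarrow> \<psi> \<in> bforms A \<Longrightarrow> M (\<lambda>a b. \<phi> a b + \<psi> a b) = M \<phi> + M \<psi>"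
    "\<And>c \<phi>. \<phi> \<in> bforms A \<Longrightarrow> M (\<lambda>a b. c * \<phi> a b) = c * M \<phi>"
    "\<And>\<phi>. \<phi> \<in> bforms A \<Longrightarrow> cmod (M \<phi>) \<le> K * bform_norm A \<phi>"
    "\<And>\<phi> \<tau>. \<phi> \<in> bforms A \<Longrightarrow> (\<And>a b. a \<in> vcarrier A \<Longrightarrow> b \<in> vcarrier A \<Longrightarrow> \<phi> a b = \<tau> (amult A a b)) \<Longrightarrow> M \<phi> = \<tau> u"
    "\<And>\<phi> a. \<phi> \<in> bforms A \<Longrightarrow> a \<in> vcarrier A \<Longrightarrow>
       M (restr2 A (\<lambda>b c. \<phi> (amult A a b) c)) = M (restr2 A (\<lambda>b c. \<phi> b (amult A c a)))"
proof -
  note dual_bimodule_def [simp]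
  have "inner_derivation A (dual_bimodule kernel_dual) (\<lambda>a P. if P \<in> vcarrier kernel_dual then the_elem P a u else 0)"
    using assms kernel_dual_bimodule kernel_dual_derivation unfolding amenable_def by blast
  then obtain N where N: "N \<in> vcarrier (dual_bimodule kernel_dual)"
    and N_eq: "\<And>a. a \<in> vcarrier A \<Longrightarrow>
      (\<lambda>P. if P \<in> vcarrier kernel_dual then the_elem P a u else 0) =
        vminus (dual_bimodule kernel_dual) (lact (dual_bimodule kernel_dual) a N) (ract (dual_bimodule kernel_dual) N a)"
    unfolding inner_derivation_def by blast
  define n where "n \<phi> = N {\<phi>}" for \<phi>
  have n_add: "n (\<lambda>a b. \<phi> a b + \<psi> a b) = n \<phi> + n \<psi>" if "\<phi> \<in> kernel_forms" "\<psi> \<in> kernel_forms" for \<phi> \<psi>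
    using N that by (fastforce simp: bounded_clinear_map_def clinear_map_def complex_space_def n_def)
  have n_scale: "n (\<lambda>a b. c * \<phi> a b) = c * n \<phi>" if "\<phi> \<in> kernel_forms" for \<phi> c
    using N that by (fastforce simp: bounded_clinear_map_def clinear_map_def complex_space_def n_def)
  obtain C where C: "\<And>\<phi>. \<phi> \<in> kernel_forms \<Longrightarrow> cmod (n \<phi>) \<le> C * bform_norm A \<phi>"
    using N by (auto simp: bounded_clinear_map_def complex_space_def n_def bform_norm_nonneg kernel_forms_bform)
  have n_eq: "\<phi> a u = n (restr2 A (\<lambda>b c. \<phi> (amult A a b) c - \<phi> a (amult A b c))) - n (restr2 A (\<lambda>b c. \<phi> b (amult A c a)))"
    if "\<phi> \<in> kernel_forms" "a \<in> vcarrier A" for \<phi> a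
    using fun_cong[OF N_eq[OF that(2)], of "{\<phi>}"] that by (simp add: vminus_def n_def)
  \<comment> \<open>The transpose of the projection of \<open>b \<otimes> c\<close> to
    \<open>b \<otimes> c - u \<otimes> bc\<close>, which lies in \<open>ker \<pi>\<close>.\<close>
  define pr where "pr \<phi> = (\<lambda>b c. \<phi> b c - restr2 A (\<lambda>b c. \<phi> u (amult A b c)) b c)" for \<phi>
  have pr: "pr \<phi> \<in> kernel_forms" if "\<phi> \<in> bforms A" for \<phi>
  proof -
    have "pr \<phi> u c = 0" for c
      using bforms_out[OF that, of u c] unfolding pr_def restr2_def
      by (simp add: unit_closed unit_left)
    moreover have "pr \<phi> \<in> bforms A"
      unfolding pr_def by (intro bforms_diff that bforms_shift_mid unit_closed)
    ultimately show ?thesis by (simp add: kernel_forms_def)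
  qed
  have pr_norm: "bform_norm A (pr \<phi>) \<le> (1 + vnorm A u) * bform_norm A \<phi>" if "\<phi> \<in> bforms A" for \<phi>
  proof -
    note mid = bforms_shift_mid[OF that unit_closed]
    have "bform_norm A (pr \<phi>) \<le> bform_norm A \<phi> + bform_norm A (\<lambda>b c. -1 * restr2 A (\<lambda>b c. \<phi> u (amult A b c)) b c)"
      using bform_norm_add[OF that bforms_scale[OF mid, of "-1"]] by (simp add: pr_def)
    then show ?thesis
      unfolding bform_norm_scale[OF mid]
      using bform_norm_shift_mid[OF that unit_closed] by (simp add: algebra_simps)
  qed
  \<comment> \<open>This is the functional \<open>u \<otimes> u - N\<close>, with \<open>N\<close>
    extended to all forms through \<open>pr\<close>.\<close>
  define M where "M \<phi> = \<phi> u u - n (pr \<phi>)" for \<phi>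
  show thesis
  proof (rule that[of M "vnorm A u * vnorm A u + \<bar>C\<bar> * (1 + vnorm A u)"], goal_cases)
    case (1 \<phi> \<psi>)
    have "pr (\<lambda>a b. \<phi> a b + \<psi> a b) = (\<lambda>a b. pr \<phi> a b + pr \<psi> a b)"
      by (auto simp: pr_def restr2_def fun_eq_iff)
    then show ?case using 1 by (simp add: M_def n_add pr)
  next
    case (2 c \<phi>)
    have "pr (\<lambda>a b. c * \<phi> a b) = (\<lambda>a b. c * pr \<phi> a b)"
      by (auto simp: pr_def restr2_def fun_eq_iff algebra_simps)
    then show ?case using 2 by (simp add: M_def n_scale pr algebra_simps)
  next
    case (3 \<phi>)
    have "cmod (n (pr \<phi>)) \<le> \<bar>C\<bar> * bform_norm A (pr \<phi>)"
      using C[OF pr[OF 3]] bform_norm_nonneg[OF kernel_forms_bform[OF pr[OF 3]]]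
      by (smt (verit) mult_right_mono)
    also have "\<dots> \<le> \<bar>C\<bar> * ((1 + vnorm A u) * bform_norm A \<phi>)"
      by (intro mult_left_mono pr_norm 3) simp
    finally have "cmod (n (pr \<phi>)) \<le> \<bar>C\<bar> * ((1 + vnorm A u) * bform_norm A \<phi>)" .
    moreover have "cmod (\<phi> u u) \<le> bform_norm A \<phi> * (vnorm A u * vnorm A u)"
      by (rule bform_le_norm[OF 3 unit_closed unit_closed])
    moreover have "cmod (M \<phi>) \<le> cmod (\<phi> u u) + cmod (n (pr \<phi>))"
      unfolding M_def by (rule norm_triangle_ineq4)
    ultimately show ?case by (simp add: algebra_simps)
  next
    case (4 \<phi> \<tau>)
    \<comment> \<open>A form that factors through the product satisfies
      \<open>\<phi> b c = \<phi> u (bc)\<close>, so the projection kills it. Writing zero as a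
      multiple lets \<open>n_scale\<close> apply.\<close>
    have "pr \<phi> = (\<lambda>a b. 0 * pr \<phi> a b)"
      using bforms_out[OF 4(1)] unfolding pr_def restr2_def fun_eq_iff
      by (simp add: 4 unit_closed unit_left amult_closed)
    then have "n (pr \<phi>) = 0" using n_scale[OF pr[OF 4(1)], of 0] by simp
    then show ?case by (simp add: M_def 4 unit_closed unit_left)
  next
    case (5 \<phi> a)
    let ?l = "restr2 A (\<lambda>b c. \<phi> (amult A a b) c)" and ?r = "restr2 A (\<lambda>b c. \<phi> b (amult A c a))"
    \<comment> \<open>\<open>pr\<close> intertwines the shifts of arbitrary forms with the two
      actions on kernel forms, which is why \<open>n_eq\<close> can be used for
      \<open>pr \<phi>\<close>.\<close>
    have "pr ?l = restr2 A (\<lambda>b c. pr \<phi> (amult A a b) c - pr \<phi> a (amult A b c))"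
      using 5(2) by (auto simp: pr_def restr2_def fun_eq_iff amult_closed unit_closed unit_right mult_assoc)
    moreover have "pr ?r = restr2 A (\<lambda>b c. pr \<phi> b (amult A c a))"
      using 5(2) by (auto simp: pr_def restr2_def fun_eq_iff amult_closed unit_closed mult_assoc)
    ultimately have "pr \<phi> a u = n (pr ?l) - n (pr ?r)"
      using n_eq[OF pr[OF 5(1)] 5(2)] by simp
    \<comment> \<open>Both sides equal \<open>\<phi> a u - \<phi> u a\<close>; this contribution of
      \<open>u \<otimes> u\<close> cancels against that of \<open>N\<close>.\<close>
    moreover have "pr \<phi> a u = ?l u u - ?r u u"
      using 5(2) by (simp add: pr_def restr2_def unit_closed unit_left unit_right)
    ultimately show ?case by (simp add: M_def algebra_simps)
  qed
qed

end

section \<open>Convolution of absolutely summable functions\<close>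

text \<open>The tensor \<open>F \<otimes> G\<close> of two summable functions, paired with a bounded
  function on the product set.\<close>

definition pairing :: "('i \<Rightarrow> complex) \<Rightarrow> ('j \<Rightarrow> complex) \<Rightarrow> ('i \<Rightarrow> 'j \<Rightarrow> complex) \<Rightarrow> complex" where
  "pairing F G \<phi> = (\<Sum>\<^sub>\<infinity>(t, z). F t * G z * \<phi> t z)"

lemma cmod_summable: "F summable_on UNIV \<Longrightarrow> (\<lambda>x. cmod (F x)) summable_on UNIV" for F :: "'i \<Rightarrow> complex"
  by (simp add: summable_on_iff_abs_summable_on_complex)

lemma has_sum_product_cmod:
  fixes F :: "'i \<Rightarrow> complex" and G :: "'j \<Rightarrow> complex"
  assumes "F summable_on UNIV" "G summable_on UNIV"
  shows "((\<lambda>(t, z). cmod (F t) * cmod (G z)) has_sum (\<Sum>\<^sub>\<infinity>t. cmod (F t)) * (\<Sum>\<^sub>\<infinity>z. cmod (G z))) UNIV"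
proof -
  have "((\<lambda>(t, z). cmod (F t) * cmod (G z)) has_sum (\<Sum>\<^sub>\<infinity>t. cmod (F t)) * (\<Sum>\<^sub>\<infinity>z. cmod (G z))) (UNIV \<times> UNIV)"
  proof (rule has_sum_SigmaI)
    show "((\<lambda>z. case (t, z) of (t, z) \<Rightarrow> cmod (F t) * cmod (G z)) has_sum cmod (F t) * (\<Sum>\<^sub>\<infinity>z. cmod (G z))) UNIV" for t
      using assms(2) by (auto intro!: has_sum_cmult_right has_sum_infsum cmod_summable)
    show "((\<lambda>t. cmod (F t) * (\<Sum>\<^sub>\<infinity>z. cmod (G z))) has_sum (\<Sum>\<^sub>\<infinity>t. cmod (F t)) * (\<Sum>\<^sub>\<infinity>z. cmod (G z))) UNIV"
      using assms(1) by (auto intro!: has_sum_cmult_left has_sum_infsum cmod_summable)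
    have "(\<lambda>tz. norm ((\<lambda>(t, z). cmod (F t) * cmod (G z)) tz)) summable_on (UNIV \<times> UNIV)"
      unfolding Infinite_Sum.abs_summable_on_Sigma_iff
      using assms by (auto simp: infsum_cmult_right' intro!: summable_on_cmult_right summable_on_cmult_left cmod_summable
        simp: abs_mult)
    then show "(\<lambda>(t, z). cmod (F t) * cmod (G z)) summable_on (UNIV \<times> UNIV)"
      by (auto simp: case_prod_unfold)
  qed
  then show ?thesis by simp
qed

text \<open>All three claims rest on the summable majorant
  \<open>B * (cmod (F t) * cmod (G z))\<close>, the last one by way of Fubini.\<close>

lemma
  assumes FG: "F summable_on UNIV" "G summable_on UNIV" and \<phi>: "\<And>t z. cmod (\<phi> t z) \<le> B"
  shows pairing_summable: "(\<lambda>(t, z). F t * G z * \<phi> t z) summable_on UNIV"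
    and pairing_bound: "cmod (pairing F G \<phi>) \<le> B * ((\<Sum>\<^sub>\<infinity>t. cmod (F t)) * (\<Sum>\<^sub>\<infinity>z. cmod (G z)))"
    and pairing_iterated: "pairing F G \<phi> = (\<Sum>\<^sub>\<infinity>t. F t * (\<Sum>\<^sub>\<infinity>z. G z * \<phi> t z))"
proof -
  have hs: "((\<lambda>(t, z). B * (cmod (F t) * cmod (G z))) has_sum B * ((\<Sum>\<^sub>\<infinity>t. cmod (F t)) * (\<Sum>\<^sub>\<infinity>z. cmod (G z)))) UNIV"
    using has_sum_cmult_right[OF has_sum_product_cmod[OF FG], of B] by (simp add: case_prod_unfold)
  have le: "cmod (F t * G z * \<phi> t z) \<le> B * (cmod (F t) * cmod (G z))" for t z
    using mult_right_mono[OF \<phi>[of t z], of "cmod (F t) * cmod (G z)"] by (simp add: norm_mult mult_ac)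
  have "(\<lambda>tz. norm ((\<lambda>(t, z). F t * G z * \<phi> t z) tz)) summable_on UNIV"
    by (rule Infinite_Sum.abs_summable_on_comparison_test'[OF has_sum_imp_summable[OF hs]]) (use le in auto)
  then show s: "(\<lambda>(t, z). F t * G z * \<phi> t z) summable_on UNIV"
    by (simp add: summable_on_iff_abs_summable_on_complex)
  show "cmod (pairing F G \<phi>) \<le> B * ((\<Sum>\<^sub>\<infinity>t. cmod (F t)) * (\<Sum>\<^sub>\<infinity>z. cmod (G z)))"
    unfolding pairing_def by (rule norm_infsum_le[OF has_sum_infsum[OF s] hs]) (use le in auto)
  have "pairing F G \<phi> = (\<Sum>\<^sub>\<infinity>t. \<Sum>\<^sub>\<infinity>z. F t * G z * \<phi> t z)"
    unfolding pairing_def using infsum_Sigma'_banach[of "\<lambda>t z. F t * G z * \<phi> t z" UNIV "\<lambda>_. UNIV"] s by simp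
  then show "pairing F G \<phi> = (\<Sum>\<^sub>\<infinity>t. F t * (\<Sum>\<^sub>\<infinity>z. G z * \<phi> t z))"
    by (simp add: infsum_cmult_right' mult.assoc)
qed

lemma pairing_add_left:
  assumes "F summable_on UNIV" "F' summable_on UNIV" "G summable_on UNIV" "\<And>t z. cmod (\<phi> t z) \<le> B"
  shows "pairing (\<lambda>x. F x + F' x) G \<phi> = pairing F G \<phi> + pairing F' G \<phi>"
  using infsum_add[OF pairing_summable[OF assms(1,3,4)] pairing_summable[OF assms(2,3,4)]]
  by (simp add: pairing_def case_prod_unfold algebra_simps)

lemma pairing_add_right:
  assumes "F summable_on UNIV" "G summable_on UNIV" "G' summable_on UNIV" "\<And>t z. cmod (\<phi> t z) \<le> B"
  shows "pairing F (\<lambda>x. G x + G' x) \<phi> = pairing F G \<phi> + pairing F G' \<phi>"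
  using infsum_add[OF pairing_summable[OF assms(1,2,4)] pairing_summable[OF assms(1,3,4)]]
  by (simp add: pairing_def case_prod_unfold algebra_simps)

lemma pairing_add_form:
  assumes "F summable_on UNIV" "G summable_on UNIV"
    "\<And>t z. cmod (\<phi> t z) \<le> B" "\<And>t z. cmod (\<psi> t z) \<le> B'"
  shows "pairing F G (\<lambda>x y. \<phi> x y + \<psi> x y) = pairing F G \<phi> + pairing F G \<psi>"
  using infsum_add[OF pairing_summable[OF assms(1,2,3)] pairing_summable[OF assms(1,2,4)]]
  by (simp add: pairing_def case_prod_unfold algebra_simps)

lemma pairing_scale:
  "pairing (\<lambda>x. c * F x) G \<phi> = c * pairing F G \<phi>"
  "pairing F (\<lambda>x. c * G x) \<phi> = c * pairing F G \<phi>"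
  "pairing F G (\<lambda>x y. c * \<phi> x y) = c * pairing F G \<phi>"
  unfolding pairing_def infsum_cmult_right'[symmetric]
  by (auto intro!: infsum_cong)

lemma pairing_single:
  assumes "\<And>t z. cmod (\<phi> t z) \<le> B" "G summable_on UNIV"
  shows "pairing (\<lambda>x. if x = a then 1 else 0) G \<phi> = (\<Sum>\<^sub>\<infinity>z. G z * \<phi> a z)"
proof -
  let ?F = "\<lambda>x. if x = a then 1 else (0 :: complex)"
  have "?F summable_on UNIV"
    by (rule finite_nonzero_values_imp_summable_on) simp
  then have "pairing ?F G \<phi> = (\<Sum>\<^sub>\<infinity>t. ?F t * (\<Sum>\<^sub>\<infinity>z. G z * \<phi> t z))"
    by (intro pairing_iterated[where B = B] assms)
  also have "\<dots> = (\<Sum>\<^sub>\<infinity>t\<in>{a}. ?F t * (\<Sum>\<^sub>\<infinity>z. G z * \<phi> t z))"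
    by (rule infsum_cong_neutral) auto
  finally show ?thesis by simp
qed

text \<open>Used to choose test functions of modulus at most 1 whose pairing with a function is the
  sum of its absolute values.\<close>

lemma mult_cnj_sgn: "w * cnj (sgn w) = of_real (cmod w)"
proof (cases "w = 0")
  case False
  have "w * cnj (sgn w) = (w * cnj w) / of_real (cmod w)" by (simp add: sgn_eq)
  also have "w * cnj w = of_real (cmod w * cmod w)"
    using complex_norm_square[of w] by (simp add: power2_eq_square)
  finally show ?thesis using False by simp
qed simp

lemma summable_on_diff:
  fixes f g :: "'i \<Rightarrow> complex"
  assumes "f summable_on S" "g summable_on S"
  shows "(\<lambda>x. f x - g x) summable_on S"
  using summable_on_add[OF assms(1) summable_on_uminus[THEN iffD2, OF assms(2)]] by simp

lemma infsum_weighted_bound: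
  fixes K :: "'i \<Rightarrow> complex"
  assumes "K summable_on UNIV" "\<And>w. cmod (h w) \<le> B"
  shows "cmod (\<Sum>\<^sub>\<infinity>w. K w * h w) \<le> B * (\<Sum>\<^sub>\<infinity>w. cmod (K w))"
proof -
  have hs: "((\<lambda>w. B * cmod (K w)) has_sum B * (\<Sum>\<^sub>\<infinity>w. cmod (K w))) UNIV"
    by (intro has_sum_cmult_right has_sum_infsum cmod_summable assms)
  have le: "cmod (K w * h w) \<le> B * cmod (K w)" for w
    using mult_right_mono[OF assms(2)[of w], of "cmod (K w)"] by (simp add: norm_mult mult.commute)
  have "(\<lambda>w. norm (K w * h w)) summable_on UNIV"
    by (rule Infinite_Sum.abs_summable_on_comparison_test'[OF has_sum_imp_summable[OF hs]]) (rule le)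
  then have "(\<lambda>w. K w * h w) summable_on UNIV"
    by (simp add: summable_on_iff_abs_summable_on_complex)
  then show ?thesis
    using norm_infsum_le[OF has_sum_infsum hs] le by blast
qed

lemma pairing_swap:
  assumes "F summable_on UNIV" "G summable_on UNIV" "\<And>t z. cmod (\<phi> t z) \<le> B"
  shows "pairing F G \<phi> = pairing G F (\<lambda>z t. \<phi> t z)"
proof -
  have s: "(\<lambda>(t, z). F t * (G z * \<phi> t z)) summable_on (UNIV \<times> UNIV)"
    using pairing_summable[OF assms] by (simp add: mult.assoc)
  show ?thesis
    unfolding pairing_iterated[OF assms] pairing_iterated[OF assms(2,1,3)]
    using infsum_swap_banach[OF s] by (simp add: mult.left_commute flip: infsum_cmult_right')
qed

section \<open>Convolution of point masses and of summable functions, relative to counting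
  measure\<close>

context discrete_hypergroup begin

abbreviation "p x y z \<equiv> pmf (hconv H x y) z"
abbreviation "iv x \<equiv> hinv H x"

text \<open>The integral of \<open>h\<close> against the probability measure
  \<open>\<delta>_x * \<delta>_y\<close>.\<close>

definition hmean :: "'h \<Rightarrow> 'h \<Rightarrow> ('h \<Rightarrow> complex) \<Rightarrow> complex" where
  "hmean x y h = (\<Sum>z\<in>set_pmf (hconv H x y). of_real (p x y z) * h z)"

lemma inj_inv: "inj (hinv H)"
  by (metis inv_inv injI)

lemma p_inv: "p (iv y) (iv x) (iv z) = p x y z"
  unfolding inv_conv[symmetric] by (rule pmf_map_inj'[OF inj_inv])

lemma p_assoc:
  "(\<Sum>u\<in>set_pmf (hconv H x y). p x y u * p u z w) = (\<Sum>v\<in>set_pmf (hconv H y z). p y z v * p x v w)"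
proof -
  have "pmf (bind_pmf (hconv H x y) (\<lambda>u. hconv H u z)) w = (\<Sum>u\<in>set_pmf (hconv H x y). p x y u * p u z w)"
    unfolding pmf_bind by (subst integral_measure_pmf[OF finite_supp]) auto
  moreover have "pmf (bind_pmf (hconv H y z) (\<lambda>v. hconv H x v)) w = (\<Sum>v\<in>set_pmf (hconv H y z). p y z v * p x v w)"
    unfolding pmf_bind by (subst integral_measure_pmf[OF finite_supp]) auto
  ultimately show ?thesis by (simp add: assoc)
qed

lemma hmean_bound:
  assumes "\<And>z. cmod (h z) \<le> B"
  shows "cmod (hmean x y h) \<le> B"
proof -
  have "cmod (hmean x y h) \<le> (\<Sum>z\<in>set_pmf (hconv H x y). p x y z * B)"
    unfolding hmean_def by (rule sum_norm_le) (simp add: norm_mult mult_left_mono assms)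
  also have "\<dots> = B"
    by (simp add: sum_distrib_right[symmetric] sum_pmf_eq_1 finite_supp)
  finally show ?thesis .
qed

lemma hmean_const: "hmean x y (\<lambda>_. c) = c"
  unfolding hmean_def sum_distrib_right[symmetric] of_real_sum[symmetric] by (simp add: sum_pmf_eq_1 finite_supp)

lemma hmean_superset:
  assumes "finite S" "set_pmf (hconv H x y) \<subseteq> S"
  shows "hmean x y h = (\<Sum>z\<in>S. of_real (p x y z) * h z)"
  unfolding hmean_def by (rule sum.mono_neutral_left[OF assms]) (simp add: set_pmf_iff)

lemma hmean_has_sum: "((\<lambda>z. of_real (p x y z) * h z) has_sum hmean x y h) UNIV"
  by (rule has_sum_finite_neutralI[OF finite_supp]) (auto simp: hmean_def set_pmf_iff)

lemma hmean_assoc: "hmean x y (\<lambda>u. hmean u z h) = hmean y z (\<lambda>v. hmean x v h)"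
proof -
  \<comment> \<open>A common finite superset of the supports lets both double sums run over the same
    \<open>w\<close>, so that the order of summation can be exchanged.\<close>
  define S where "S = (\<Union>u\<in>set_pmf (hconv H x y). set_pmf (hconv H u z)) \<union> (\<Union>v\<in>set_pmf (hconv H y z). set_pmf (hconv H x v))"
  have S: "finite S" by (simp add: S_def finite_supp)
  have "hmean x y (\<lambda>u. hmean u z h) = (\<Sum>u\<in>set_pmf (hconv H x y). \<Sum>w\<in>S. of_real (p x y u) * (of_real (p u z w) * h w))"
    unfolding hmean_def[of x y] sum_distrib_left[symmetric]
    by (intro sum.cong refl arg_cong2[where f = times] hmean_superset S) (auto simp: S_def)
  also have "\<dots> = (\<Sum>w\<in>S. of_real (\<Sum>u\<in>set_pmf (hconv H x y). p x y u * p u z w) * h w)"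
    by (subst sum.swap) (simp add: sum_distrib_right mult.assoc)
  also have "\<dots> = (\<Sum>v\<in>set_pmf (hconv H y z). \<Sum>w\<in>S. of_real (p y z v) * (of_real (p x v w) * h w))"
    unfolding p_assoc by (subst sum.swap) (simp add: sum_distrib_right mult.assoc)
  also have "\<dots> = hmean y z (\<lambda>v. hmean x v h)"
    unfolding hmean_def[of y z] sum_distrib_left[symmetric]
    by (intro sum.cong refl arg_cong2[where f = times] hmean_superset[symmetric] S) (auto simp: S_def)
  finally show ?thesis .
qed

lemma hmean_indicator: "hmean x y (\<lambda>u. if u = w then 1 else 0) = of_real (p x y w)"
  unfolding hmean_def using finite_supp[of x y]
  by (cases "w \<in> set_pmf (hconv H x y)") (auto simp: if_distrib set_pmf_iff cong: if_cong)

text \<open>Convolution of \<open>F\<close> and \<open>G\<close> regarded as complex measures; the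
  Haar measure does not enter here.\<close>

definition hprod :: "('h \<Rightarrow> complex) \<Rightarrow> ('h \<Rightarrow> complex) \<Rightarrow> 'h \<Rightarrow> complex" where
  "hprod F G x = pairing F G (\<lambda>t z. of_real (p t z x))"

lemma cmod_p_le: "cmod (of_real (p x y z)) \<le> 1"
  by (simp add: pmf_le_1)

text \<open>Fubini for the triple sum over \<open>t\<close>, \<open>z\<close>, \<open>x\<close>.
  Summing absolute values over \<open>x\<close> first produces a mean of \<open>cmod (h x)\<close>,
  which is at most \<open>B\<close>, so the sum over pairs has the usual product majorant.\<close>

lemma
  assumes FG: "F summable_on UNIV" "G summable_on UNIV" and h: "\<And>x. cmod (h x) \<le> B"
  shows hprod_pairing_summable: "(\<lambda>x. hprod F G x * h x) summable_on UNIV"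
    and hprod_pairing: "(\<Sum>\<^sub>\<infinity>x. hprod F G x * h x) = pairing F G (\<lambda>t z. hmean t z h)"
proof -
  let ?\<Phi> = "\<lambda>(t, z) x. F t * G z * (of_real (p t z x) * h x)"
  \<comment> \<open>The means are complex valued; the real part recovers the real mean of
    \<open>cmod (h x)\<close>.\<close>
  have hs: "((\<lambda>x. cmod (?\<Phi> (t, z) x)) has_sum cmod (F t * G z) * Re (hmean t z (\<lambda>x. of_real (cmod (h x))))) UNIV" for t z
    using has_sum_cmult_right[OF has_sum_Re[OF hmean_has_sum[of t z "\<lambda>x. of_real (cmod (h x))"]], of "cmod (F t * G z)"]
    by (simp add: norm_mult)
  have "(\<lambda>q. norm ((\<lambda>(tz, x). ?\<Phi> tz x) q)) summable_on (UNIV \<times> UNIV)"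
    unfolding Infinite_Sum.abs_summable_on_Sigma_iff
  proof (intro conjI ballI)
    fix tz :: "'h \<times> 'h"
    show "(\<lambda>x. norm (case (tz, x) of (tz, x) \<Rightarrow> ?\<Phi> tz x)) summable_on UNIV"
      using has_sum_imp_summable[OF hs[of "fst tz" "snd tz"]] by (simp add: case_prod_unfold)
  next
    have eq: "(\<Sum>\<^sub>\<infinity>x. cmod (?\<Phi> tz x)) = cmod (F (fst tz) * G (snd tz)) * Re (hmean (fst tz) (snd tz) (\<lambda>x. of_real (cmod (h x))))" for tz
      using infsumI[OF hs[of "fst tz" "snd tz"]] by (simp add: case_prod_unfold)
    have le: "\<bar>Re (hmean t z (\<lambda>x. of_real (cmod (h x))))\<bar> \<le> B" for t z
      by (rule order_trans[OF abs_Re_le_cmod hmean_bound]) (simp add: h)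
    have "(\<lambda>tz. norm (\<Sum>\<^sub>\<infinity>x. cmod (?\<Phi> tz x))) summable_on UNIV"
    proof (rule Infinite_Sum.abs_summable_on_comparison_test'[where g = "\<lambda>(t, z). B * (cmod (F t) * cmod (G z))"])
      show "(\<lambda>(t, z). B * (cmod (F t) * cmod (G z))) summable_on UNIV"
        using summable_on_cmult_right[OF has_sum_imp_summable[OF has_sum_product_cmod[OF FG]], of B]
        by (simp add: case_prod_unfold)
      fix tz :: "'h \<times> 'h"
      show "norm (\<Sum>\<^sub>\<infinity>x. cmod (?\<Phi> tz x)) \<le> (case tz of (t, z) \<Rightarrow> B * (cmod (F t) * cmod (G z)))"
        unfolding eq using mult_right_mono[OF le[of "fst tz" "snd tz"], of "cmod (F (fst tz)) * cmod (G (snd tz))"]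
        by (simp add: abs_mult norm_mult case_prod_unfold mult_ac)
    qed
    then show "(\<lambda>tz. norm (\<Sum>\<^sub>\<infinity>x. norm (case (tz, x) of (tz, x) \<Rightarrow> ?\<Phi> tz x))) summable_on UNIV"
      by simp
  qed
  then have s: "(\<lambda>(tz, x). ?\<Phi> tz x) summable_on (UNIV \<times> UNIV)"
    by (simp only: summable_on_iff_abs_summable_on_complex)
  then have s': "(\<lambda>(x, tz). ?\<Phi> tz x) summable_on (UNIV \<times> UNIV)"
    by (subst summable_on_swap) (simp add: case_prod_unfold)
  have hprod: "(\<Sum>\<^sub>\<infinity>tz. ?\<Phi> tz x) = hprod F G x * h x" for x
    unfolding hprod_def pairing_def infsum_cmult_left'[symmetric]
    by (rule infsum_cong) (auto simp: mult_ac)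
  show "(\<lambda>x. hprod F G x * h x) summable_on UNIV"
    using summable_on_Sigma_banach[OF s'] by (simp add: hprod)
  have "(\<Sum>\<^sub>\<infinity>x. hprod F G x * h x) = (\<Sum>\<^sub>\<infinity>tz. \<Sum>\<^sub>\<infinity>x. ?\<Phi> tz x)"
    unfolding hprod[symmetric] by (rule infsum_swap_banach[OF s'])
  also have "\<dots> = pairing F G (\<lambda>t z. hmean t z h)"
    unfolding pairing_def
    by (rule infsum_cong) (auto simp: infsum_cmult_right' infsumI[OF hmean_has_sum])
  finally show "(\<Sum>\<^sub>\<infinity>x. hprod F G x * h x) = pairing F G (\<lambda>t z. hmean t z h)" .
qed

abbreviation point :: "'h \<Rightarrow> 'h \<Rightarrow> complex" where
  "point a \<equiv> (\<lambda>x. if x = a then 1 else 0)"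

lemma point_summable: "point a summable_on UNIV"
  by (rule finite_nonzero_values_imp_summable_on) simp

lemma hprod_summable:
  assumes "F summable_on UNIV" "G summable_on UNIV"
  shows "hprod F G summable_on UNIV"
  using hprod_pairing_summable[OF assms, of "\<lambda>_. 1" 1] by simp

text \<open>The masses of \<open>hconv H x y\<close> form a summable function, so the interchange is
  an instance of \<open>pairing_swap\<close>.\<close>

lemma infsum_hmean:
  assumes "K summable_on UNIV" "\<And>t z. cmod (\<phi> t z) \<le> B"
  shows "hmean x y (\<lambda>u. \<Sum>\<^sub>\<infinity>w. K w * \<phi> u w) = (\<Sum>\<^sub>\<infinity>w. K w * hmean x y (\<lambda>u. \<phi> u w))"
proof -
  have s: "(\<lambda>z. of_real (p x y z) :: complex) summable_on UNIV"
    using has_sum_imp_summable[OF hmean_has_sum[of x y "\<lambda>_. 1"]] by simp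
  have "hmean x y (\<lambda>u. \<Sum>\<^sub>\<infinity>w. K w * \<phi> u w) = pairing (\<lambda>z. of_real (p x y z)) K \<phi>"
    unfolding pairing_iterated[OF s assms] by (rule infsumI[OF hmean_has_sum, symmetric])
  also have "\<dots> = pairing K (\<lambda>z. of_real (p x y z)) (\<lambda>w u. \<phi> u w)"
    by (rule pairing_swap[OF s assms])
  also have "\<dots> = (\<Sum>\<^sub>\<infinity>w. K w * (\<Sum>\<^sub>\<infinity>u. of_real (p x y u) * \<phi> u w))"
    by (rule pairing_iterated[OF assms(1) s assms(2)])
  finally show ?thesis by (simp add: infsumI[OF hmean_has_sum])
qed

text \<open>Transposes a convolution in the first variable to an average of the kernel, both for
  associativity and for the invariance of the diagonal.\<close>

lemma pairing_hprod_left: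
  assumes "F summable_on UNIV" "G summable_on UNIV" "K summable_on UNIV" "\<And>t z. cmod (\<phi> t z) \<le> B"
  shows "pairing (hprod F G) K \<phi> = pairing F G (\<lambda>t z. \<Sum>\<^sub>\<infinity>w. K w * hmean t z (\<lambda>u. \<phi> u w))"
proof -
  have "pairing (hprod F G) K \<phi> = (\<Sum>\<^sub>\<infinity>u. hprod F G u * (\<Sum>\<^sub>\<infinity>w. K w * \<phi> u w))"
    by (rule pairing_iterated[OF hprod_summable[OF assms(1,2)] assms(3,4)])
  also have "\<dots> = pairing F G (\<lambda>t z. hmean t z (\<lambda>u. \<Sum>\<^sub>\<infinity>w. K w * \<phi> u w))"
    by (rule hprod_pairing[OF assms(1,2) infsum_weighted_bound[OF assms(3,4)]])
  finally show ?thesis unfolding infsum_hmean[OF assms(3,4)] .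
qed

lemma pairing_hprod_right:
  assumes "F summable_on UNIV" "G summable_on UNIV" "K summable_on UNIV" "\<And>t z. cmod (\<phi> t z) \<le> B"
  shows "pairing F (hprod G K) \<phi> = (\<Sum>\<^sub>\<infinity>t. F t * pairing G K (\<lambda>z w. hmean z w (\<phi> t)))"
  unfolding pairing_iterated[OF assms(1) hprod_summable[OF assms(2,3)] assms(4)]
    hprod_pairing[OF assms(2,3,4)] ..

lemma hprod_assoc:
  assumes "F summable_on UNIV" "G summable_on UNIV" "K summable_on UNIV"
  shows "hprod (hprod F G) K = hprod F (hprod G K)"
proof
  fix x
  have bd: "cmod (hmean t z (\<lambda>u. of_real (p u w x))) \<le> 1" for t z w
    by (rule hmean_bound) (rule cmod_p_le)
  have "hprod (hprod F G) K x = pairing F G (\<lambda>t z. \<Sum>\<^sub>\<infinity>w. K w * hmean t z (\<lambda>u. of_real (p u w x)))"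
    unfolding hprod_def[of "hprod F G"] by (rule pairing_hprod_left[OF assms cmod_p_le])
  also have "\<dots> = (\<Sum>\<^sub>\<infinity>t. F t * (\<Sum>\<^sub>\<infinity>z. G z * (\<Sum>\<^sub>\<infinity>w. K w * hmean t z (\<lambda>u. of_real (p u w x)))))"
    by (rule pairing_iterated[OF assms(1,2) infsum_weighted_bound[OF assms(3) bd]])
  \<comment> \<open>The mass \<open>p u w x\<close> is itself the mean of an indicator, so
    associativity of means applies.\<close>
  also have "\<dots> = (\<Sum>\<^sub>\<infinity>t. F t * (\<Sum>\<^sub>\<infinity>z. G z * (\<Sum>\<^sub>\<infinity>w. K w * hmean z w (\<lambda>v. of_real (p t v x)))))"
    unfolding hmean_indicator[symmetric] hmean_assoc ..
  also have "\<dots> = (\<Sum>\<^sub>\<infinity>t. F t * pairing G K (\<lambda>z w. hmean z w (\<lambda>v. of_real (p t v x))))"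
    using pairing_iterated[OF assms(2,3) hmean_bound[OF cmod_p_le]] by simp
  also have "\<dots> = hprod F (hprod G K) x"
    unfolding hprod_def[of F "hprod G K"] by (rule pairing_hprod_right[OF assms cmod_p_le, symmetric])
  finally show "hprod (hprod F G) K x = hprod F (hprod G K) x" .
qed

text \<open>By duality: pairing \<open>hprod F G\<close> with its conjugate signs gives its norm,
  and the means of a function bounded by 1 are again bounded by 1.\<close>

lemma hprod_norm:
  assumes "F summable_on UNIV" "G summable_on UNIV"
  shows "(\<Sum>\<^sub>\<infinity>x. cmod (hprod F G x)) \<le> (\<Sum>\<^sub>\<infinity>t. cmod (F t)) * (\<Sum>\<^sub>\<infinity>z. cmod (G z))"
proof -
  let ?h = "\<lambda>x. cnj (sgn (hprod F G x))"
  have h: "cmod (?h x) \<le> 1" for x by (simp add: norm_sgn)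
  have "((\<lambda>x. of_real (cmod (hprod F G x))) has_sum (of_real (\<Sum>\<^sub>\<infinity>x. cmod (hprod F G x)) :: complex)) UNIV"
    by (intro has_sum_of_real has_sum_infsum cmod_summable hprod_summable assms)
  then have "of_real (\<Sum>\<^sub>\<infinity>x. cmod (hprod F G x)) = pairing F G (\<lambda>t z. hmean t z ?h)"
    using hprod_pairing[OF assms, of ?h 1] h by (simp add: mult_cnj_sgn infsumI)
  moreover have "cmod (pairing F G (\<lambda>t z. hmean t z ?h)) \<le> 1 * ((\<Sum>\<^sub>\<infinity>t. cmod (F t)) * (\<Sum>\<^sub>\<infinity>z. cmod (G z)))"
    by (rule pairing_bound[OF assms hmean_bound[OF h]])
  ultimately show ?thesis
    by (metis abs_le_D1 mult_1 norm_of_real)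
qed

lemma hprod_point_left:
  assumes "F summable_on UNIV"
  shows "hprod (point (hunit H)) F = F"
proof
  fix x
  have "hprod (point (hunit H)) F x = (\<Sum>\<^sub>\<infinity>z. F z * of_real (p (hunit H) z x))"
    unfolding hprod_def by (rule pairing_single[OF cmod_p_le assms])
  also have "\<dots> = (\<Sum>\<^sub>\<infinity>z\<in>{x}. F z * of_real (p (hunit H) z x))"
    by (rule infsum_cong_neutral) (auto simp: unit_left)
  finally show "hprod (point (hunit H)) F x = F x" by (simp add: unit_left)
qed

lemma hprod_point_right:
  assumes "F summable_on UNIV"
  shows "hprod F (point (hunit H)) = F"
proof
  fix x
  have "hprod F (point (hunit H)) x = (\<Sum>\<^sub>\<infinity>z. F z * of_real (p z (hunit H) x))"
    unfolding hprod_def pairing_swap[OF assms point_summable cmod_p_le]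
    by (rule pairing_single[OF cmod_p_le assms])
  also have "\<dots> = (\<Sum>\<^sub>\<infinity>z\<in>{x}. F z * of_real (p z (hunit H) x))"
    by (rule infsum_cong_neutral) (auto simp: unit_right)
  finally show "hprod F (point (hunit H)) x = F x" by (simp add: unit_right)
qed

end

section \<open>Haar measure and the hypergroup algebra\<close>

locale hypergroup_haar = discrete_hypergroup H for H :: "'h hypergroup_data" +
  fixes \<mu> :: "'h \<Rightarrow> real"
  assumes haar: "haar_measure H \<mu>"
begin

section \<open>Haar masses and the adjoint relation\<close>

lemma haar_unit: "\<mu> (hunit H) = 1"
  using haar by (simp add: haar_measure_def)

text \<open>Invariance is tested on the indicator of the identity. By the axiom on supports, its
  translate by \<open>x\<close> lives at \<open>x\<close> alone.\<close>

lemma haar_inverse: "p (iv x) x (hunit H) * \<mu> x = 1"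
proof -
  let ?f = "point (hunit H)"
  have lt: "ltrans H x ?f y = of_real (p (iv x) y (hunit H))" for y
    unfolding ltrans_def using hmean_indicator[of "iv x" y "hunit H"] by (simp add: hmean_def scaleR_conv_of_real)
  have "(\<Sum>\<^sub>\<infinity>y. ltrans H x ?f y * of_real (\<mu> y)) = (\<Sum>\<^sub>\<infinity>y\<in>{x}. ltrans H x ?f y * of_real (\<mu> y))"
  proof (rule infsum_cong_neutral)
    fix y assume "y \<in> UNIV - {x}"
    then have "hunit H \<notin> set_pmf (hconv H (iv x) y)"
      using inj_inv by (auto simp: unit_in_supp inj_eq)
    then show "ltrans H x ?f y * of_real (\<mu> y) = 0" by (simp add: lt set_pmf_iff)
  qed auto
  moreover have "(\<Sum>\<^sub>\<infinity>y. ?f y * of_real (\<mu> y)) = (\<Sum>\<^sub>\<infinity>y\<in>{hunit H}. ?f y * of_real (\<mu> y))"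
    by (rule infsum_cong_neutral) auto
  moreover have "(\<Sum>\<^sub>\<infinity>y. ltrans H x ?f y * of_real (\<mu> y)) = (\<Sum>\<^sub>\<infinity>y. ?f y * of_real (\<mu> y))"
    using haar unfolding haar_measure_def by simp
  ultimately have "of_real (p (iv x) x (hunit H) * \<mu> x) = (1 :: complex)"
    by (simp add: lt haar_unit)
  then show ?thesis by (simp only: of_real_eq_1_iff)
qed

text \<open>\<open>\<mu> x\<close> is the reciprocal of a probability.\<close>

lemma haar_ge_1: "1 \<le> \<mu> x"
proof -
  have "0 \<le> \<mu> x" using haar by (simp add: haar_measure_def)
  then have "p (iv x) x (hunit H) * \<mu> x \<le> 1 * \<mu> x"
    by (intro mult_right_mono pmf_le_1)
  then show ?thesis by (simp add: haar_inverse)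
qed

lemma haar_pos: "0 < \<mu> x"
  using haar_ge_1[of x] by linarith

lemma p_unit: "p x y (hunit H) = (if x = iv y then 1 / \<mu> y else 0)"
  using haar_inverse[of y] haar_pos[of y] unit_in_supp[of x y]
  by (auto simp: set_pmf_iff field_simps)

text \<open>Compares the masses at the identity of the two bracketings of the product of
  \<open>iv z\<close>, \<open>iv x\<close> and \<open>y\<close>; on each side \<open>p_unit\<close>
  leaves one term. It says that translations by \<open>x\<close> and \<open>iv x\<close> are adjoint
  with respect to \<open>\<mu>\<close>.\<close>

lemma haar_adjoint: "\<mu> z * p x z y = \<mu> y * p (iv x) y z"
proof -
  have *: "(\<Sum>u\<in>set_pmf N. pmf N u * (if u = w then c else 0)) = pmf N w * c" if "finite (set_pmf N)" for N :: "'h pmf" and w c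
    using that by (cases "w \<in> set_pmf N") (auto simp: if_distrib set_pmf_iff cong: if_cong)
  have "(\<Sum>u\<in>set_pmf (hconv H (iv z) (iv x)). p (iv z) (iv x) u * (if u = iv y then 1 / \<mu> y else 0)) =
    (\<Sum>v\<in>set_pmf (hconv H (iv x) y). p (iv x) y v * (if v = z then 1 / \<mu> z else 0))"
    using p_assoc[of "iv z" "iv x" y "hunit H"] inj_inv
    by (simp add: p_unit inj_eq haar_unit eq_commute[of z] cong: if_cong)
  then have "p x z y / \<mu> y = p (iv x) y z / \<mu> z"
    by (simp add: * finite_supp p_inv)
  then show ?thesis using haar_pos[of z] haar_pos[of y] by (simp add: field_simps)
qed

text \<open>Finiteness is given in the output variable \<open>y\<close>; the adjoint relation moves
  it to the factor \<open>z\<close>, as \<open>\<mu>\<close> never vanishes.\<close>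

lemma finite_adjoint_supp: "finite {z. p x z y \<noteq> 0}"
proof (rule finite_subset[OF _ finite_supp[of "iv x" y]])
  show "{z. p x z y \<noteq> 0} \<subseteq> set_pmf (hconv H (iv x) y)"
  proof
    fix z assume "z \<in> {z. p x z y \<noteq> 0}"
    then have "\<mu> z * p x z y \<noteq> 0" using haar_pos[of z] by simp
    then show "z \<in> set_pmf (hconv H (iv x) y)" unfolding haar_adjoint[of z x y] by (simp add: set_pmf_iff)
  qed
qed

text \<open>The involution exchanges the two factors.\<close>

lemma finite_adjoint_supp': "finite {x. p x z y \<noteq> 0}"
proof -
  have "{x. p x z y \<noteq> 0} = hinv H -` {x. p (iv z) x (iv y) \<noteq> 0}"
    by (auto simp: p_inv)
  then show ?thesis using finite_vimageI[OF finite_adjoint_supp inj_inv] by simp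
qed

text \<open>The decay estimate behind the whole argument: the mass at a fixed point \<open>y\<close>
  is small where \<open>\<mu> z\<close> is large, uniformly in \<open>x\<close>.\<close>

lemma p_le: "p x z y \<le> \<mu> y / \<mu> z"
proof -
  have "\<mu> z * p x z y \<le> \<mu> y * 1"
    unfolding haar_adjoint[of z x y] by (intro mult_left_mono pmf_le_1) (simp add: haar_pos less_imp_le)
  then show ?thesis using haar_pos[of z] by (simp add: field_simps)
qed

section \<open>The hypergroup algebra carried over to summable functions\<close>

abbreviation "A \<equiv> hypergroup_algebra H \<mu>"

text \<open>Passing from densities to measures: an isometry onto the summable functions which takes
  the product of \<open>A\<close> to \<open>hprod\<close>. All algebra laws are checked on that
  side.\<close>

definition weighted :: "('h \<Rightarrow> complex) \<Rightarrow> 'h \<Rightarrow> complex" where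
  "weighted f x = f x * of_real (\<mu> x)"

definition unweighted :: "('h \<Rightarrow> complex) \<Rightarrow> 'h \<Rightarrow> complex" where
  "unweighted F x = F x / of_real (\<mu> x)"

lemma weighted_unweighted: "weighted (unweighted F) = F" and unweighted_weighted: "unweighted (weighted f) = f"
  using haar_pos by (auto simp: weighted_def unweighted_def fun_eq_iff less_imp_neq[THEN not_sym])

lemma weighted_inj: "weighted f = weighted g \<Longrightarrow> f = g"
  by (metis unweighted_weighted)

lemma cmod_weighted: "cmod (weighted f x) = cmod (f x) * \<mu> x"
  using haar_pos[of x] by (simp add: weighted_def norm_mult)

lemma carrier_iff: "f \<in> vcarrier A \<longleftrightarrow> weighted f summable_on UNIV"
  by (simp add: hypergroup_algebra_def Lp_def summable_on_iff_abs_summable_on_complex cmod_weighted)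

lemma norm_eq: "vnorm A f = (\<Sum>\<^sub>\<infinity>x. cmod (weighted f x))"
  unfolding hypergroup_algebra_def Lp_norm_def
  by (simp add: cmod_weighted infsum_nonneg haar_pos less_imp_le)

lemma algebra_ops:
  "vzero A = (\<lambda>x. 0)" "vadd A f g = (\<lambda>x. f x + g x)" "vscale A c f = (\<lambda>x. c * f x)"
  by (simp_all add: hypergroup_algebra_def)

lemma weighted_ops:
  "weighted (vzero A) = (\<lambda>x. 0)" "weighted (vadd A f g) = (\<lambda>x. weighted f x + weighted g x)" "weighted (vscale A c f) = (\<lambda>x. c * weighted f x)"
  "weighted (vminus A f g) = (\<lambda>x. weighted f x - weighted g x)"
  by (simp_all add: algebra_ops vminus_def weighted_def fun_eq_iff algebra_simps)

text \<open>By the adjoint relation, translating the density by \<open>t\<close> amounts to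
  convolving the measure with the point mass at \<open>t\<close>.\<close>

lemma ltrans_weighted: "ltrans H t g x * of_real (\<mu> x) = (\<Sum>\<^sub>\<infinity>z. weighted g z * of_real (p t z x))"
proof -
  have eq: "of_real (p (iv t) x z) * (g z * of_real (\<mu> x)) = weighted g z * of_real (p t z x)" for z
    using arg_cong[OF haar_adjoint[of z t x], of "of_real :: real \<Rightarrow> complex"]
    by (simp add: weighted_def mult_ac)
  have "ltrans H t g x * of_real (\<mu> x) = hmean (iv t) x (\<lambda>z. g z * of_real (\<mu> x))"
    unfolding ltrans_def hmean_def by (simp add: sum_distrib_right scaleR_conv_of_real mult.assoc)
  also have "\<dots> = (\<Sum>\<^sub>\<infinity>z. of_real (p (iv t) x z) * (g z * of_real (\<mu> x)))"
    by (rule infsumI[OF hmean_has_sum, symmetric])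
  finally show ?thesis by (simp add: eq)
qed

lemma weighted_amult:
  assumes "f \<in> vcarrier A" "g \<in> vcarrier A"
  shows "weighted (amult A f g) = hprod (weighted f) (weighted g)"
proof
  fix x
  have "weighted (amult A f g) x = (\<Sum>\<^sub>\<infinity>t. f t * ltrans H t g x * of_real (\<mu> t) * of_real (\<mu> x))"
    by (simp add: weighted_def hypergroup_algebra_def infsum_cmult_left')
  also have "\<dots> = (\<Sum>\<^sub>\<infinity>t. weighted f t * (\<Sum>\<^sub>\<infinity>z. weighted g z * of_real (p t z x)))"
    unfolding ltrans_weighted[symmetric] by (simp add: weighted_def mult_ac)
  also have "\<dots> = hprod (weighted f) (weighted g) x"
    unfolding hprod_def using assms
    by (intro pairing_iterated[where B = 1, symmetric] cmod_p_le) (simp_all add: carrier_iff)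
  finally show "weighted (amult A f g) x = hprod (weighted f) (weighted g) x" .
qed

lemma banach_space: "complex_banach_space A"
\<comment> \<open>A value at \<open>x\<close> is at most the norm divided by the mass of
  \<open>x\<close>.\<close>
proof (rule complex_banach_space_eval[where ev = "\<lambda>f. f" and C = "\<lambda>x. 1 / \<mu> x"], goal_cases)
  case (9 x y)
  then show ?case by (simp add: norm_eq weighted_ops norm_minus_commute)
next
  case (11 x y)
  then have "(\<Sum>\<^sub>\<infinity>i. cmod (weighted x i + weighted y i)) \<le> (\<Sum>\<^sub>\<infinity>i. cmod (weighted x i) + cmod (weighted y i))"
    by (intro infsum_mono summable_on_add cmod_summable norm_triangle_ineq) (simp_all add: carrier_iff)
  also have "\<dots> = (\<Sum>\<^sub>\<infinity>i. cmod (weighted x i)) + (\<Sum>\<^sub>\<infinity>i. cmod (weighted y i))"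
    using 11 by (intro infsum_add cmod_summable) (simp_all add: carrier_iff)
  finally show ?case by (simp add: norm_eq weighted_ops)
next
  case (12 x i)
  then have "(\<Sum>j\<in>{i}. cmod (weighted x j)) \<le> (\<Sum>\<^sub>\<infinity>j. cmod (weighted x j))"
    by (intro finite_sum_le_infsum cmod_summable) (simp_all add: carrier_iff)
  then show ?case using haar_pos[of i] by (simp add: cmod_weighted norm_eq field_simps)
next
  case (13 \<sigma> l)
  \<comment> \<open>Finite partial sums pass to the pointwise limit with the same bound; this yields
    both summability of the difference and the norm estimate.\<close>
  have part: "(\<Sum>x\<in>S. cmod (weighted (\<sigma> n) x - weighted l x)) \<le> r"
    if r: "\<forall>m\<ge>n. vnorm A (vminus A (\<sigma> n) (\<sigma> m)) \<le> r" and S: "finite S" for n r S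
  proof (rule tendsto_upperbound)
    show "(\<lambda>m. \<Sum>x\<in>S. cmod (weighted (\<sigma> n) x - weighted (\<sigma> m) x)) \<longlonglongrightarrow> (\<Sum>x\<in>S. cmod (weighted (\<sigma> n) x - weighted l x))"
      unfolding weighted_def by (intro tendsto_intros 13)
    have "(\<Sum>x\<in>S. cmod (weighted (\<sigma> n) x - weighted (\<sigma> m) x)) \<le> r" if "m \<ge> n" for m
    proof -
      have "(\<Sum>x\<in>S. cmod (weighted (\<sigma> n) x - weighted (\<sigma> m) x)) \<le> (\<Sum>\<^sub>\<infinity>x. cmod (weighted (\<sigma> n) x - weighted (\<sigma> m) x))"
        using 13(1) S by (intro finite_sum_le_infsum cmod_summable summable_on_diff) (simp_all add: carrier_iff)
      then show ?thesis using r that by (fastforce simp: norm_eq weighted_ops)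
    qed
    then show "\<forall>\<^sub>F m in sequentially. (\<Sum>x\<in>S. cmod (weighted (\<sigma> n) x - weighted (\<sigma> m) x)) \<le> r"
      by (auto simp: eventually_sequentially)
  qed simp
  have summ: "(\<lambda>x. cmod (weighted (\<sigma> n) x - weighted l x)) summable_on UNIV"
    if "\<forall>m\<ge>n. vnorm A (vminus A (\<sigma> n) (\<sigma> m)) \<le> r" for n r
    by (rule nonneg_bounded_partial_sums_imp_summable_on[where C = r])
      (use part[OF that] in \<open>auto intro!: eventually_finite_subsets_at_top_weakI\<close>)
  obtain N where N: "\<forall>m\<ge>N. vnorm A (vminus A (\<sigma> N) (\<sigma> m)) \<le> 1"
    using 13(2)[of 1] by auto
  have "(\<lambda>x. weighted (\<sigma> N) x - weighted l x) summable_on UNIV"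
    using summ[OF N] by (simp add: summable_on_iff_abs_summable_on_complex)
  \<comment> \<open>The limit is recovered as \<open>\<sigma> N\<close> minus a summable
    difference.\<close>
  then have "(\<lambda>x. weighted (\<sigma> N) x - (weighted (\<sigma> N) x - weighted l x)) summable_on UNIV"
    by (rule summable_on_diff[rotated]) (use 13(1)[of N] in \<open>simp add: carrier_iff\<close>)
  then have "l \<in> vcarrier A" by (simp add: carrier_iff)
  moreover have "vnorm A (vminus A (\<sigma> n) l) \<le> r"
    if "\<forall>m\<ge>n. vnorm A (vminus A (\<sigma> n) (\<sigma> m)) \<le> r" for n r
    unfolding norm_eq weighted_ops
    by (rule infsum_le_finite_sums[OF summ[OF that]]) (rule part[OF that])
  ultimately show ?case by blast
next
  case (10 c x)
  then show ?case by (simp add: norm_eq weighted_ops norm_mult infsum_cmult_right')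
qed (simp_all add: algebra_ops carrier_iff weighted_ops[unfolded algebra_ops] norm_eq infsum_nonneg summable_on_add summable_on_cmult_right)

lemma L1_amult_closed: "f \<in> vcarrier A \<Longrightarrow> g \<in> vcarrier A \<Longrightarrow> amult A f g \<in> vcarrier A"
  by (simp add: carrier_iff weighted_amult hprod_summable)

lemma L1_vadd_closed: "f \<in> vcarrier A \<Longrightarrow> g \<in> vcarrier A \<Longrightarrow> vadd A f g \<in> vcarrier A"
  by (simp add: carrier_iff weighted_ops summable_on_add)

lemma L1_vscale_closed: "f \<in> vcarrier A \<Longrightarrow> vscale A c f \<in> vcarrier A"
  by (simp add: carrier_iff weighted_ops summable_on_cmult_right)

lemma amult_add:
  assumes "f \<in> vcarrier A" "g \<in> vcarrier A" "h \<in> vcarrier A"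
  shows "amult A (vadd A f g) h = vadd A (amult A f h) (amult A g h)"
    "amult A h (vadd A f g) = vadd A (amult A h f) (amult A h g)"
  by (rule weighted_inj, rule ext, use assms in \<open>simp add: L1_vadd_closed weighted_amult weighted_ops hprod_def carrier_iff[THEN iffD1]
    pairing_add_left[OF _ _ _ cmod_p_le] pairing_add_right[OF _ _ _ cmod_p_le]\<close>)+

lemma amult_scale:
  assumes "f \<in> vcarrier A" "h \<in> vcarrier A"
  shows "amult A (vscale A c f) h = vscale A c (amult A f h)"
    "amult A h (vscale A c f) = vscale A c (amult A h f)"
  by (rule weighted_inj, rule ext, use assms in \<open>simp add: L1_vscale_closed weighted_amult weighted_ops hprod_def pairing_scale\<close>)+

lemma unital_banach_algebra: "unital_banach_algebra A (unweighted (point (hunit H)))"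
proof -
  interpret complex_banach_space A by (rule banach_space)
  show ?thesis
  proof (unfold_locales, goal_cases)
    case (1 a)
    then show ?case by (simp add: clinear_map_def L1_amult_closed amult_add(2) amult_scale(2))
  next
    case (2 b)
    then show ?case by (simp add: clinear_map_def L1_amult_closed amult_add(1) amult_scale(1))
  next
    case (3 a b c)
    then show ?case
      by - (rule weighted_inj, simp add: weighted_amult L1_amult_closed hprod_assoc carrier_iff[THEN iffD1])
  next
    case (4 a b)
    then show ?case using hprod_norm by (simp add: norm_eq weighted_amult carrier_iff[THEN iffD1])
  next
    case 5
    then show ?case by (simp add: carrier_iff weighted_unweighted point_summable)
  next
    case (6 a)
    then show ?case by - (rule weighted_inj, simp add: weighted_amult carrier_iff weighted_unweighted point_summable hprod_point_left)
  next
    case (7 a)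
    then show ?case by - (rule weighted_inj, simp add: weighted_amult carrier_iff weighted_unweighted point_summable hprod_point_right)
  qed
qed

text \<open>Lets a bounded function on pairs act as a bilinear form, so that the virtual diagonal
  becomes a functional on bounded functions.\<close>

definition form_of :: "('h \<Rightarrow> 'h \<Rightarrow> complex) \<Rightarrow> ('h \<Rightarrow> complex) \<Rightarrow> ('h \<Rightarrow> complex) \<Rightarrow> complex" where
  "form_of \<phi> = restr2 A (\<lambda>f g. pairing (weighted f) (weighted g) \<phi>)"

lemma form_of_apply: "f \<in> vcarrier A \<Longrightarrow> g \<in> vcarrier A \<Longrightarrow> form_of \<phi> f g = pairing (weighted f) (weighted g) \<phi>"
  by (simp add: form_of_def restr2_def)

lemma
  assumes "\<And>x y. cmod (\<phi> x y) \<le> B"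
  shows form_of_bforms: "form_of \<phi> \<in> bforms A" and form_of_norm: "bform_norm A (form_of \<phi>) \<le> B"
proof -
  interpret unital_banach_algebra A "unweighted (point (hunit H))" by (rule unital_banach_algebra)
  have B: "0 \<le> B" using order_trans[OF norm_ge_zero assms] .
  have bd: "cmod (pairing (weighted f) (weighted g) \<phi>) \<le> B * (vnorm A f * vnorm A g)" if "f \<in> vcarrier A" "g \<in> vcarrier A" for f g
    unfolding norm_eq using that by (intro pairing_bound assms) (simp_all add: carrier_iff)
  show "form_of \<phi> \<in> bforms A"
    unfolding form_of_def
    by (rule restr2_bforms[OF _ _ _ _ B bd])
      (simp_all add: weighted_ops carrier_iff pairing_scale
        pairing_add_left[OF _ _ _ assms] pairing_add_right[OF _ _ _ assms])
  show "bform_norm A (form_of \<phi>) \<le> B"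
    by (rule bform_norm_le[OF B]) (simp add: form_of_apply bd)
qed

text \<open>The virtual diagonal composed with \<open>form_of\<close>. The function
  \<open>hmean x y h\<close> corresponds to integrating \<open>h\<close> against a product in
  \<open>A\<close>, which yields the value at the identity; commutation with the point mass at
  \<open>x\<close> becomes an identity between averages in the first and in the second
  variable.\<close>

lemma diagonal_functional:
  assumes "amenable A"
  obtains m K where "0 \<le> K"
    "\<And>\<phi> \<psi> B C. (\<And>x y. cmod (\<phi> x y) \<le> B) \<Longrightarrow> (\<And>x y. cmod (\<psi> x y) \<le> C) \<Longrightarrow>
       m (\<lambda>x y. \<phi> x y + \<psi> x y) = m \<phi> + m \<psi>"
    "\<And>\<phi> c B. (\<And>x y. cmod (\<phi> x y) \<le> B) \<Longrightarrow> m (\<lambda>x y. c * \<phi> x y) = c * m \<phi>"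
    "\<And>\<phi> B. (\<And>x y. cmod (\<phi> x y) \<le> B) \<Longrightarrow> cmod (m \<phi>) \<le> K * B"
    "\<And>h B. (\<And>x. cmod (h x) \<le> B) \<Longrightarrow> m (\<lambda>x y. hmean x y h) = h (hunit H)"
    "\<And>\<phi> x B. (\<And>x y. cmod (\<phi> x y) \<le> B) \<Longrightarrow> m (\<lambda>z y. hmean x z (\<lambda>u. \<phi> u y)) = m (\<lambda>z y. hmean y x (\<phi> z))"
proof -
  interpret unital_banach_algebra A "unweighted (point (hunit H))" by (rule unital_banach_algebra)
  obtain M K where M:
    "\<And>\<phi> \<psi>. \<phi> \<in> bforms A \<Longrightarrow> \<psi> \<in> bforms A \<Longrightarrow> M (\<lambda>a b. \<phi> a b + \<psi> a b) = M \<phi> + M \<psi>"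
    "\<And>c \<phi>. \<phi> \<in> bforms A \<Longrightarrow> M (\<lambda>a b. c * \<phi> a b) = c * M \<phi>"
    "\<And>\<phi>. \<phi> \<in> bforms A \<Longrightarrow> cmod (M \<phi>) \<le> K * bform_norm A \<phi>"
    "\<And>\<phi> \<tau>. \<phi> \<in> bforms A \<Longrightarrow> (\<And>a b. a \<in> vcarrier A \<Longrightarrow> b \<in> vcarrier A \<Longrightarrow> \<phi> a b = \<tau> (amult A a b)) \<Longrightarrow> M \<phi> = \<tau> (unweighted (point (hunit H)))"
    "\<And>\<phi> a. \<phi> \<in> bforms A \<Longrightarrow> a \<in> vcarrier A \<Longrightarrow>
       M (restr2 A (\<lambda>b c. \<phi> (amult A a b) c)) = M (restr2 A (\<lambda>b c. \<phi> b (amult A c a)))"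
    using virtual_diagonal[OF assms] by blast
  show thesis
  proof (rule that[of "\<bar>K\<bar>" "\<lambda>\<phi>. M (form_of \<phi>)"], goal_cases)
    case 1
    then show ?case by simp
  next
    case (2 \<phi> \<psi> B C)
    have "form_of (\<lambda>x y. \<phi> x y + \<psi> x y) = (\<lambda>f g. form_of \<phi> f g + form_of \<psi> f g)"
      by (auto simp: form_of_def restr2_def fun_eq_iff carrier_iff intro!: pairing_add_form[where B=B and B'=C] 2)
    then show ?case using M(1)[OF form_of_bforms[OF 2(1)] form_of_bforms[OF 2(2)]] by simp
  next
    case (3 \<phi> c B)
    have "form_of (\<lambda>x y. c * \<phi> x y) = (\<lambda>f g. c * form_of \<phi> f g)"
      by (auto simp: form_of_def restr2_def fun_eq_iff pairing_scale)
    then show ?case using M(2)[OF form_of_bforms[OF 3]] by simp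
  next
    case (4 \<phi> B)
    have "cmod (M (form_of \<phi>)) \<le> K * bform_norm A (form_of \<phi>)" by (rule M(3)[OF form_of_bforms[OF 4]])
    also have "\<dots> \<le> \<bar>K\<bar> * bform_norm A (form_of \<phi>)"
      by (intro mult_right_mono bform_norm_nonneg[OF form_of_bforms[OF 4]]) simp
    also have "\<dots> \<le> \<bar>K\<bar> * B" by (intro mult_left_mono form_of_norm[OF 4]) simp
    finally show ?case .
  next
    case (5 h B)
    have "M (form_of (\<lambda>x y. hmean x y h)) = (\<lambda>f. \<Sum>\<^sub>\<infinity>x. weighted f x * h x) (unweighted (point (hunit H)))"
    proof (rule M(4))
      show "form_of (\<lambda>x y. hmean x y h) \<in> bforms A" by (rule form_of_bforms[OF hmean_bound[OF 5]])
      fix f g assume "f \<in> vcarrier A" "g \<in> vcarrier A"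
      then show "form_of (\<lambda>x y. hmean x y h) f g = (\<Sum>\<^sub>\<infinity>x. weighted (amult A f g) x * h x)"
        by (simp add: form_of_apply weighted_amult carrier_iff hprod_pairing[OF _ _ 5])
    qed
    also have "\<dots> = (\<Sum>\<^sub>\<infinity>x\<in>{hunit H}. point (hunit H) x * h x)"
      unfolding weighted_unweighted by (rule infsum_cong_neutral) auto
    finally show ?case by simp
  next
    case (6 \<phi> x B)
    \<comment> \<open>The density whose measure is the point mass at \<open>x\<close>.\<close>
    let ?a = "unweighted (point x)"
    have a: "?a \<in> vcarrier A" by (simp add: carrier_iff weighted_unweighted point_summable)
    have "restr2 A (\<lambda>f g. form_of \<phi> (amult A ?a f) g) = form_of (\<lambda>z y. hmean x z (\<lambda>u. \<phi> u y))"
    proof (intro ext)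
      fix f g
      show "restr2 A (\<lambda>f g. form_of \<phi> (amult A ?a f) g) f g = form_of (\<lambda>z y. hmean x z (\<lambda>u. \<phi> u y)) f g"
      proof (cases "f \<in> vcarrier A \<and> g \<in> vcarrier A")
        case True
        then have fg: "f \<in> vcarrier A" "g \<in> vcarrier A" and s: "weighted f summable_on UNIV" "weighted g summable_on UNIV"
          by (simp_all add: carrier_iff)
        have "pairing (hprod (point x) (weighted f)) (weighted g) \<phi> = pairing (point x) (weighted f) (\<lambda>t z. \<Sum>\<^sub>\<infinity>w. weighted g w * hmean t z (\<lambda>u. \<phi> u w))"
          by (rule pairing_hprod_left[OF point_summable s 6])
        also have "\<dots> = (\<Sum>\<^sub>\<infinity>z. weighted f z * (\<Sum>\<^sub>\<infinity>w. weighted g w * hmean x z (\<lambda>u. \<phi> u w)))"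
          by (rule pairing_single[OF infsum_weighted_bound[OF s(2) hmean_bound[OF 6]] s(1)])
        also have "\<dots> = pairing (weighted f) (weighted g) (\<lambda>z y. hmean x z (\<lambda>u. \<phi> u y))"
          by (rule pairing_iterated[OF s hmean_bound[OF 6], symmetric])
        finally show ?thesis
          using fg a by (simp add: restr2_def form_of_apply L1_amult_closed weighted_amult weighted_unweighted)
      qed (auto simp: restr2_def form_of_def)
    qed
    moreover have "restr2 A (\<lambda>f g. form_of \<phi> f (amult A g ?a)) = form_of (\<lambda>z y. hmean y x (\<phi> z))"
    proof (intro ext)
      fix f g
      show "restr2 A (\<lambda>f g. form_of \<phi> f (amult A g ?a)) f g = form_of (\<lambda>z y. hmean y x (\<phi> z)) f g"
      proof (cases "f \<in> vcarrier A \<and> g \<in> vcarrier A")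
        case True
        then have fg: "f \<in> vcarrier A" "g \<in> vcarrier A" and s: "weighted f summable_on UNIV" "weighted g summable_on UNIV"
          by (simp_all add: carrier_iff)
        have "pairing (weighted g) (point x) (\<lambda>y w. hmean y w (\<phi> t)) = (\<Sum>\<^sub>\<infinity>y. weighted g y * hmean y x (\<phi> t))" for t
          unfolding pairing_swap[OF s(2) point_summable hmean_bound[OF 6]]
          by (rule pairing_single[OF hmean_bound[OF 6] s(2)])
        then have "pairing (weighted f) (hprod (weighted g) (point x)) \<phi> = (\<Sum>\<^sub>\<infinity>t. weighted f t * (\<Sum>\<^sub>\<infinity>y. weighted g y * hmean y x (\<phi> t)))"
          unfolding pairing_hprod_right[OF s point_summable 6] by simp
        also have "\<dots> = pairing (weighted f) (weighted g) (\<lambda>z y. hmean y x (\<phi> z))"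
          by (rule pairing_iterated[OF s hmean_bound[OF 6], symmetric])
        finally show ?thesis
          using fg a by (simp add: restr2_def form_of_apply L1_amult_closed weighted_amult weighted_unweighted)
      qed (auto simp: restr2_def form_of_def)
    qed
    ultimately show ?case using M(5)[OF form_of_bforms[of \<phi>, OF 6] a] by simp
  qed
qed

section \<open>Amenability and bounded Haar measure\<close>

lemma infinite_bounded_haar:
  assumes amen: "amenable A" and inf: "infinite (UNIV :: 'h set)"
  shows "\<exists>M\<ge>1. infinite {x. \<mu> x \<le> M}"
proof (rule ccontr)
  assume "\<not> (\<exists>M\<ge>1. infinite {x. \<mu> x \<le> M})"
  then have fin: "finite {x. \<mu> x \<le> M}" if "M \<ge> 1" for M using that by blast
  show False
  proof (rule diagonal_functional[OF amen])
    fix m K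
    assume K: "0 \<le> K"
      and m_add: "\<And>\<phi> \<psi> B C. (\<And>x y. cmod (\<phi> x y) \<le> B) \<Longrightarrow> (\<And>x y. cmod (\<psi> x y) \<le> C) \<Longrightarrow>
         m (\<lambda>x y. \<phi> x y + \<psi> x y) = m \<phi> + m \<psi>"
      and m_scale: "\<And>\<phi> c B. (\<And>x y. cmod (\<phi> x y) \<le> B) \<Longrightarrow> m (\<lambda>x y. c * \<phi> x y) = c * m \<phi>"
      and m_bound: "\<And>\<phi> B. (\<And>x y. cmod (\<phi> x y) \<le> B) \<Longrightarrow> cmod (m \<phi>) \<le> K * B"
      and m_diag: "\<And>h B. (\<And>x. cmod (h x) \<le> B) \<Longrightarrow> m (\<lambda>x y. hmean x y h) = h (hunit H)"
      and m_shift: "\<And>\<phi> x B. (\<And>x y. cmod (\<phi> x y) \<le> B) \<Longrightarrow> m (\<lambda>z y. hmean x z (\<lambda>u. \<phi> u y)) = m (\<lambda>z y. hmean y x (\<phi> z))"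

    \<comment> \<open>The summable coefficients of \<open>m\<close>\<close>
    define \<delta> :: "'h \<Rightarrow> 'h \<Rightarrow> 'h \<Rightarrow> 'h \<Rightarrow> complex" where "\<delta> z y = (\<lambda>z' y'. if z' = z \<and> y' = y then 1 else 0)" for z y
    \<comment> \<open>The arguments are exchanged so that a column, with \<open>y\<close> fixed, is
      the partial application \<open>c y\<close>.\<close>
    define c where "c y z = m (\<delta> z y)" for y z
    have \<delta>_bound: "cmod (\<delta> z y z' y') \<le> 1" for z y z' y' by (simp add: \<delta>_def)
    have m_finite: "m \<phi> = (\<Sum>(y, z)\<in>T. \<phi> z y * c y z)"
      if "finite T" "\<And>y z. (y, z) \<notin> T \<Longrightarrow> \<phi> z y = 0" for T \<phi>
      using that
    proof (induction T arbitrary: \<phi> rule: finite_induct)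
      case empty
      then have "\<phi> = (\<lambda>x y. 0 * \<phi> x y)" by (simp add: fun_eq_iff)
      moreover have "cmod (\<phi> x y) \<le> 0" for x y using empty by simp
      ultimately show ?case using m_scale[of \<phi> 0 0] by simp
    next
      case (insert q T)
      obtain y z where q: "q = (y, z)" by (cases q)
      define \<psi> where "\<psi> z' y' = (if z' = z \<and> y' = y then 0 else \<phi> z' y')" for z' y'
      have \<psi>0: "\<psi> z' y' = 0" if "(y', z') \<notin> T" for y' z'
        using insert.prems[of y' z'] that by (auto simp: \<psi>_def q)
      \<comment> \<open>Additivity of \<open>m\<close> is available for bounded functions; the sum
        over the finite support serves as a bound.\<close>
      have "\<exists>B. \<forall>z' y'. cmod (\<psi> z' y') \<le> B"
      proof (intro exI allI)
        fix z' y'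
        show "cmod (\<psi> z' y') \<le> (\<Sum>(y, z)\<in>T. cmod (\<psi> z y))"
        proof (cases "(y', z') \<in> T")
          case True
          then show ?thesis
            using member_le_sum[of "(y', z')" T "\<lambda>(y, z). cmod (\<psi> z y)"] insert.hyps(1) by auto
        qed (auto simp: \<psi>0 intro!: sum_nonneg)
      qed
      then obtain B where B: "\<And>z' y'. cmod (\<psi> z' y') \<le> B" by blast
      have "\<phi> = (\<lambda>z' y'. \<phi> z y * \<delta> z y z' y' + \<psi> z' y')"
        by (auto simp: fun_eq_iff \<psi>_def \<delta>_def)
      then have "m \<phi> = m (\<lambda>z' y'. \<phi> z y * \<delta> z y z' y') + m \<psi>"
        using m_add[of "\<lambda>z' y'. \<phi> z y * \<delta> z y z' y'" "cmod (\<phi> z y)" \<psi> B] B \<delta>_bound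
        by (simp add: norm_mult mult_left_le)
      also have "m (\<lambda>z' y'. \<phi> z y * \<delta> z y z' y') = \<phi> z y * c y z"
        unfolding c_def by (rule m_scale[OF \<delta>_bound])
      also have "m \<psi> = (\<Sum>(y, z)\<in>T. \<psi> z y * c y z)" by (rule insert.IH[OF \<psi>0])
      also have "\<dots> = (\<Sum>(y, z)\<in>T. \<phi> z y * c y z)"
        using insert.hyps(2) by (intro sum.cong) (auto simp: \<psi>_def q)
      finally show ?case using insert.hyps by (simp add: q)
    qed

    have c_sum: "(\<Sum>(y, z)\<in>T. cmod (c y z)) \<le> K" if "finite T" for T
    proof -
      \<comment> \<open>Conjugate signs on \<open>T\<close> make \<open>m\<close> return the sum of
        the absolute values, while the test function has supremum at most 1.\<close>
      let ?\<phi> = "\<lambda>z y. if (y, z) \<in> T then cnj (sgn (c y z)) else 0"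
      have "m ?\<phi> = (\<Sum>(y, z)\<in>T. ?\<phi> z y * c y z)" by (rule m_finite[OF that]) simp
      also have "\<dots> = (\<Sum>(y, z)\<in>T. of_real (cmod (c y z)))"
        by (rule sum.cong) (auto simp: mult_cnj_sgn mult.commute)
      also have "\<dots> = of_real (\<Sum>(y, z)\<in>T. cmod (c y z))" by (simp add: case_prod_unfold)
      finally have eq: "m ?\<phi> = of_real (\<Sum>(y, z)\<in>T. cmod (c y z))" .
      have "0 \<le> (\<Sum>(y, z)\<in>T. cmod (c y z))" by (intro sum_nonneg) auto
      then have "cmod (m ?\<phi>) = (\<Sum>(y, z)\<in>T. cmod (c y z))"
        unfolding eq norm_of_real by (rule abs_of_nonneg)
      moreover have "cmod (m ?\<phi>) \<le> K * 1" by (rule m_bound) (simp add: norm_sgn)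
      ultimately show ?thesis by simp
    qed
    have abs_c: "(\<lambda>(y, z). cmod (c y z)) summable_on UNIV"
      by (rule nonneg_bounded_partial_sums_imp_summable_on[where C = K])
        (use c_sum in \<open>auto intro!: eventually_finite_subsets_at_top_weakI\<close>)
    then have sum_c: "(\<lambda>(y, z). c y z) summable_on UNIV"
      by (simp add: summable_on_iff_abs_summable_on_complex case_prod_unfold)
    have sum_cy: "c y summable_on UNIV" for y
      using summable_on_SigmaD1[of c UNIV "\<lambda>_. UNIV" y] sum_c by simp
    define C where "C y = (\<Sum>\<^sub>\<infinity>z. c y z)" for y

    \<comment> \<open>Vanishing of the column sums\<close>
    have C_shift: "C (iv x) = of_real (\<mu> x) * C (hunit H)" for x
    proof -
      \<comment> \<open>Invariance is tested on the unit mass at \<open>(w, e)\<close>. Averaging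
        the first variable gives the column at \<open>e\<close> convolved with the point mass at
        \<open>x\<close>; averaging the second gives the unit mass at \<open>(w, iv x)\<close>
        divided by \<open>\<mu> x\<close>, by \<open>p_unit\<close>.\<close>
      have rel: "c (iv x) w = of_real (\<mu> x) * hprod (point x) (c (hunit H)) w" for w
      proof -
        let ?T = "(\<lambda>z. (hunit H, z)) ` {z. p x z w \<noteq> 0}"
        have ind: "hmean x z (\<lambda>u. \<delta> w (hunit H) u y) = (if y = hunit H then of_real (p x z w) else 0)" for z y
          by (cases "y = hunit H") (simp_all add: \<delta>_def hmean_indicator hmean_const)
        have "m (\<lambda>z y. hmean x z (\<lambda>u. \<delta> w (hunit H) u y)) = (\<Sum>(y, z)\<in>?T. hmean x z (\<lambda>u. \<delta> w (hunit H) u y) * c y z)"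
          by (rule m_finite) (auto simp: finite_adjoint_supp ind)
        also have "\<dots> = (\<Sum>z | p x z w \<noteq> 0. c (hunit H) z * of_real (p x z w))"
          by (subst sum.reindex) (auto simp: inj_on_def ind mult.commute)
        also have "\<dots> = (\<Sum>\<^sub>\<infinity>z. c (hunit H) z * of_real (p x z w))"
          by (rule infsumI[OF has_sum_finite_neutralI[OF finite_adjoint_supp], symmetric]) auto
        also have "\<dots> = hprod (point x) (c (hunit H)) w"
          unfolding hprod_def by (rule pairing_single[OF cmod_p_le sum_cy, symmetric])
        finally have 1: "m (\<lambda>z y. hmean x z (\<lambda>u. \<delta> w (hunit H) u y)) = hprod (point x) (c (hunit H)) w" .
        have "hmean y x (\<delta> w (hunit H) z) = 1 / of_real (\<mu> x) * \<delta> w (iv x) z y" for z y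
          by (cases "z = w") (auto simp: \<delta>_def hmean_indicator p_unit hmean_const)
        then have "m (\<lambda>z y. hmean y x (\<delta> w (hunit H) z)) = 1 / of_real (\<mu> x) * c (iv x) w"
          using m_scale[of "\<delta> w (iv x)" 1 "1 / of_real (\<mu> x)"] \<delta>_bound by (simp add: c_def)
        then show ?thesis
          using 1 m_shift[of "\<delta> w (hunit H)" 1 x] \<delta>_bound haar_pos[of x] by (simp add: field_simps)
      qed
      \<comment> \<open>Convolution with a point mass preserves total sums: pair with the constant
        function 1.\<close>
      have "C (iv x) = of_real (\<mu> x) * (\<Sum>\<^sub>\<infinity>w. hprod (point x) (c (hunit H)) w * 1)"
        unfolding C_def rel by (simp add: infsum_cmult_right')
      also have "(\<Sum>\<^sub>\<infinity>w. hprod (point x) (c (hunit H)) w * 1) = pairing (point x) (c (hunit H)) (\<lambda>t z. 1)"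
        using hprod_pairing[OF point_summable sum_cy, of "\<lambda>_. 1" 1] by (simp add: hmean_const)
      also have "\<dots> = C (hunit H)"
        unfolding C_def by (subst pairing_single[where B = 1]) (simp_all add: sum_cy)
      finally show ?thesis .
    qed

    have C0: "C y = 0" for y
    proof -
      \<comment> \<open>The column norms are summable over \<open>y\<close>, yet each is at least
        \<open>cmod (C (hunit H))\<close> because \<open>\<mu> \<ge> 1\<close>. On an infinite set
        this common lower bound must be zero.\<close>
      define N where "N y = (\<Sum>\<^sub>\<infinity>z. cmod (c y z))" for y
      have N: "N summable_on UNIV"
        unfolding N_def using summable_on_Sigma_banach[of "\<lambda>y z. cmod (c y z)" UNIV "\<lambda>_. UNIV"] abs_c by simp
      have "cmod (C (hunit H)) \<le> N y" for y
      proof -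
        have "cmod (C (hunit H)) \<le> \<mu> (iv y) * cmod (C (hunit H))"
          using mult_right_mono[OF haar_ge_1[of "iv y"], of "cmod (C (hunit H))"] by simp
        also have "\<dots> = cmod (C y)"
          using C_shift[of "iv y"] haar_pos[of "iv y"] by (simp add: inv_inv norm_mult)
        also have "\<dots> \<le> N y"
          unfolding C_def N_def by (rule norm_infsum_bound) (simp add: cmod_summable[OF sum_cy])
        finally show ?thesis .
      qed
      then have le: "real (card F) * cmod (C (hunit H)) \<le> infsum N UNIV" if "finite F" for F :: "'h set"
      proof -
        have "real (card F) * cmod (C (hunit H)) \<le> sum N F"
          using sum_mono[of F "\<lambda>_. cmod (C (hunit H))" N] \<open>\<And>y. cmod (C (hunit H)) \<le> N y\<close> by simp
        also have "\<dots> \<le> infsum N UNIV"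
          by (rule finite_sum_le_infsum[OF N that]) (auto simp: N_def infsum_nonneg)
        finally show ?thesis .
      qed
      have "C (hunit H) = 0"
      proof (rule ccontr)
        assume "C (hunit H) \<noteq> 0"
        then have pos: "cmod (C (hunit H)) > 0" by simp
        obtain n :: nat where n: "infsum N UNIV < real n * cmod (C (hunit H))"
          using reals_Archimedean3[OF pos] by blast
        obtain F :: "'h set" where "finite F" "card F = n"
          using infinite_arbitrarily_large[OF inf, of n] by blast
        then show False using le[of F] n by simp
      qed
      then show ?thesis using C_shift[of "iv y"] by (simp add: inv_inv)
    qed

    \<comment> \<open>The contradiction from the indicator of a finite set\<close>
    obtain T0 where T0: "finite T0" "dist (\<Sum>(y, z)\<in>T0. cmod (c y z)) (\<Sum>\<^sub>\<infinity>(y, z). cmod (c y z)) \<le> 1 / 4"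
      using infsum_finite_approximation[OF abs_c, of "1 / 4"] by auto
    \<comment> \<open>All but at most 1/4 of the mass of \<open>c\<close> sits on \<open>T0\<close>.
      \<open>G\<close> contains the supports of the products of pairs in \<open>T0\<close>, so the
      means of its indicator equal 1 there; containing the identity makes \<open>m_diag\<close>
      return 1.\<close>
    define G where "G = insert (hunit H) (\<Union>(y, z)\<in>T0. set_pmf (hconv H z y))"
    have G: "finite G" using T0(1) by (auto simp: G_def finite_supp)
    define g :: "'h \<Rightarrow> complex" where "g = indicator G"
    have g1: "cmod (g x) \<le> 1" for x by (simp add: g_def indicator_def)
    define r where "r z y = hmean z y g" for z y
    have r1: "cmod (r z y - 1) \<le> 1" for z y
    proof -
      have "r z y - 1 = hmean z y (\<lambda>w. g w - 1)"
        using hmean_const[of z y 1] by (simp add: r_def hmean_def sum_subtractf right_diff_distrib)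
      then show ?thesis by (simp only:) (rule hmean_bound, simp add: g_def indicator_def)
    qed
    have r_T0: "r z y = 1" if "(y, z) \<in> T0" for y z
    proof -
      have "set_pmf (hconv H z y) \<subseteq> G" using that unfolding G_def by blast
      then have "g w = 1" if "w \<in> set_pmf (hconv H z y)" for w
        using that by (auto simp: g_def)
      then have "r z y = hmean z y (\<lambda>_. 1)"
        unfolding r_def hmean_def by (intro sum.cong) simp_all
      then show ?thesis by (simp add: hmean_const)
    qed
    have r_sum: "r z y = (\<Sum>w\<in>G. of_real (p z y w))" for z y
    proof -
      have "r z y = (\<Sum>w\<in>set_pmf (hconv H z y) \<union> G. of_real (p z y w) * g w)"
        unfolding r_def by (rule hmean_superset) (auto simp: finite_supp G)
      also have "\<dots> = (\<Sum>w\<in>G. of_real (p z y w))"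
        by (rule sum.mono_neutral_cong_right) (auto simp: finite_supp G g_def)
      finally show ?thesis .
    qed
    define L where "L = sum \<mu> G"
    have L: "0 \<le> L" unfolding L_def by (intro sum_nonneg) (simp add: haar_pos less_imp_le)
    have r_le: "cmod (r z y) \<le> L / \<mu> y" for z y
    proof -
      have "cmod (r z y) \<le> (\<Sum>w\<in>G. \<mu> w / \<mu> y)"
        unfolding r_sum by (rule sum_norm_le) (simp add: p_le)
      then show ?thesis by (simp add: L_def sum_divide_distrib)
    qed
    \<comment> \<open>Chosen so that \<open>K * (L / M0) \<le> 1 / 4\<close>; the maximum with 1
      makes \<open>fin\<close> applicable and \<open>M0\<close> positive.\<close>
    define M0 where "M0 = max 1 (4 * K * L)"
    define S where "S = {y. \<mu> y \<le> M0}"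
    have S: "finite S" unfolding S_def by (rule fin) (simp add: M0_def)
    \<comment> \<open>The means split into a finitely supported part, where \<open>m\<close> is
      summation against \<open>c\<close>, and a part uniformly bounded by
      \<open>L / M0\<close>.\<close>
    define \<phi>1 where "\<phi>1 z y = (if y \<in> S then r z y else 0)" for z y
    define \<phi>2 where "\<phi>2 z y = (if y \<in> S then 0 else r z y)" for z y

    have b1: "cmod (\<phi>1 z y) \<le> 1" for z y
      using hmean_bound[OF g1] by (simp add: \<phi>1_def r_def)
    have b2: "cmod (\<phi>2 z y) \<le> L / M0" for z y
    proof (cases "y \<in> S")
      case False
      then have "L / \<mu> y \<le> L / M0"
        using L by (intro divide_left_mono) (auto simp: S_def M0_def haar_pos)
      then show ?thesis using r_le[of z y] False by (simp add: \<phi>2_def)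
    qed (use L in \<open>simp add: \<phi>2_def M0_def\<close>)
    have "m (\<lambda>z y. \<phi>1 z y + \<phi>2 z y) = m \<phi>1 + m \<phi>2" by (rule m_add[OF b1 b2])
    moreover have "(\<lambda>z y. \<phi>1 z y + \<phi>2 z y) = (\<lambda>z y. hmean z y g)"
      by (auto simp: \<phi>1_def \<phi>2_def r_def fun_eq_iff)
    moreover have "m (\<lambda>z y. hmean z y g) = 1"
      using m_diag[OF g1] by (simp add: g_def G_def)
    ultimately have one: "m \<phi>1 + m \<phi>2 = 1" by simp
    have "cmod (m \<phi>2) \<le> K * (L / M0)" by (rule m_bound[OF b2])
    also have "\<dots> \<le> 1 / 4" by (simp add: M0_def field_simps max_def)
    finally have m2: "cmod (m \<phi>2) \<le> 1 / 4" .

    have "((\<lambda>(y, z). \<phi>1 z y * c y z) has_sum m \<phi>1) UNIV"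
    proof (rule has_sum_finite_neutralI)
      \<comment> \<open>\<open>r z y\<close> is nonzero only if some point of \<open>G\<close> has
        positive mass in the product; for fixed \<open>y\<close> this leaves finitely many
        \<open>z\<close>, by \<open>finite_adjoint_supp'\<close>.\<close>
      let ?T = "S \<times> (\<Union>y\<in>S. \<Union>w\<in>G. {z. p z y w \<noteq> 0})"
      show fT: "finite ?T" using S G finite_adjoint_supp' by auto
      have zero: "\<phi>1 z y = 0" if "(y, z) \<notin> ?T" for y z
        using that by (auto simp: \<phi>1_def r_sum intro!: sum.neutral)
      show "m \<phi>1 = (\<Sum>(y, z)\<in>?T. \<phi>1 z y * c y z)" by (rule m_finite[OF fT zero])
      show "(case q of (y, z) \<Rightarrow> \<phi>1 z y * c y z) = 0" if "q \<in> UNIV - ?T" for q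
        using that zero by (cases q) auto
    qed simp
    \<comment> \<open>As every column sum is zero, the columns over \<open>S\<close> may be
      subtracted without changing the sum. This replaces the factor \<open>r z y\<close> by
      \<open>r z y - 1\<close>, which vanishes on \<open>T0\<close>.\<close>
    moreover have "((\<lambda>(y, z). - (if y \<in> S then c y z else 0)) has_sum 0) UNIV"
    proof -
      have "(\<lambda>(y, z). c y z) summable_on S \<times> UNIV"
        by (rule summable_on_subset_banach[OF sum_c]) simp
      moreover have "infsum (\<lambda>(y, z). c y z) (S \<times> UNIV) = 0"
        using infsum_Sigma'_banach[OF calculation] C0 by (simp add: C_def[symmetric])
      ultimately have "((\<lambda>(y, z). c y z) has_sum 0) (S \<times> UNIV)"
        by (metis has_sum_infsum)
      then have "((\<lambda>(y, z). if y \<in> S then c y z else 0) has_sum 0) UNIV"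
        by (subst has_sum_cong_neutral[where T = "S \<times> UNIV" and g = "\<lambda>(y, z). c y z"]) (auto split: if_splits)
      from has_sum_cmult_right[OF this, of "-1"] show ?thesis
        by (simp add: case_prod_unfold)
    qed
    ultimately have d: "((\<lambda>q. (\<lambda>(y, z). \<phi>1 z y * c y z) q + (\<lambda>(y, z). - (if y \<in> S then c y z else 0)) q) has_sum (m \<phi>1 + 0)) UNIV"
      by (rule has_sum_add)
    \<comment> \<open>The majorant is \<open>cmod (c y z)\<close> with its values on
      \<open>T0\<close> removed, of total at most 1/4.\<close>
    have "((\<lambda>q. (\<lambda>(y, z). cmod (c y z)) q + (if q \<in> T0 then - (\<lambda>(y, z). cmod (c y z)) q else 0)) has_sum
        ((\<Sum>\<^sub>\<infinity>(y, z). cmod (c y z)) + - (\<Sum>(y, z)\<in>T0. cmod (c y z)))) UNIV"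
    proof (rule has_sum_add[OF has_sum_infsum[OF abs_c]])
      show "((\<lambda>q. if q \<in> T0 then - (\<lambda>(y, z). cmod (c y z)) q else 0) has_sum - (\<Sum>(y, z)\<in>T0. cmod (c y z))) UNIV"
        by (rule has_sum_finite_neutralI[OF T0(1)]) (auto simp: sum_negf)
    qed
    then have "cmod (m \<phi>1 + 0) \<le> (\<Sum>\<^sub>\<infinity>(y, z). cmod (c y z)) + - (\<Sum>(y, z)\<in>T0. cmod (c y z))"
    proof (rule norm_infsum_le[OF d])
      fix q :: "'h \<times> 'h"
      obtain y z where q: "q = (y, z)" by (cases q)
      show "cmod ((\<lambda>(y, z). \<phi>1 z y * c y z) q + (\<lambda>(y, z). - (if y \<in> S then c y z else 0)) q) \<le>
        (\<lambda>(y, z). cmod (c y z)) q + (if q \<in> T0 then - (\<lambda>(y, z). cmod (c y z)) q else 0)"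
      proof (cases "y \<in> S")
        case True
        have "cmod ((r z y - 1) * c y z) \<le> 1 * cmod (c y z)"
          unfolding norm_mult by (intro mult_right_mono r1) simp
        then show ?thesis using r_T0[of y z] True by (auto simp: q \<phi>1_def left_diff_distrib)
      qed (auto simp: q \<phi>1_def)
    qed
    then have "cmod (m \<phi>1) \<le> 1 / 4" using T0(2) unfolding dist_real_def add_0_right by linarith
    then have "cmod (m \<phi>1 + m \<phi>2) \<le> 1 / 2" using m2 norm_triangle_ineq[of "m \<phi>1" "m \<phi>2"] by linarith
    then show False using one by simp
  qed
qed

end

theorem theorem4p1:
  fixes H :: "'h hypergroup_data" and \<mu> :: "'h \<Rightarrow> real"
  assumes "commutative_discrete_hypergroup H"
    and "infinite (UNIV :: 'h set)"
    and "haar_measure H \<mu>"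
    and "P2 H \<mu>"
    and "amenable (hypergroup_algebra H \<mu>)"
  shows "\<exists>M::real. M \<ge> 1 \<and> infinite {x. \<mu> x \<le> M}"
proof -
  interpret commutative_discrete_hypergroup H by (rule assms(1))
  interpret hypergroup_haar H \<mu> by unfold_locales (rule assms(3))
  show ?thesis using infinite_bounded_haar[OF assms(5,2)] by blast
qed

end
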